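(* Let $a\ge b>0$, let $w_A,w_B\ge 0$ with $w_A+w_B=1$, and let $H:[0,\infty)\to[0,\infty)$ be continuous and strictly increasing with $H(0)=0$ and $\lim_{c\to+\infty}H(c)=+\infty$. Consider the R-Lotto game with regulator strategy set $\mathcal C=\mathbb R$, and for $c\in\mathbb R$ let $P(c):=\Pi_A(\bar F_x^c,\bar F_y^c;c)$ be Player A's payoff at the Nash equilibrium of the followers' subgame with intervention parameter $c$. The regulator components $c^*$ of Nash--Stackelberg equilibria $(F_x^*,F_y^*;c^* )$ of the game are characterized as follows (i.e., $c^*$ is an NSE intervention if and only if the stated condition holds): (i) If $w_A=w_B$, then $c^*=0$. (ii) If $w_A>w_B$, then $$c^*\in\arg\max_{-c_1\le c\le 0}\{(w_A-w_B)P(c)-H(-c)\},$$ where $c_1$ is the unique solution of $H(c_1)=(w_A-w_B)\frac{b}{2a}$. (iii) If $w_A<w_B$, then $$c^*\in\arg\max_{0\le c\le c_2}\{(w_A-w_B)P(c)-H(c)\},$$ where $c_2$ is the unique solution of $H(c_2)=-(w_A-w_B)\left(1-\frac{b}{2a}\right)$.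
   Context: Followers' subgame with parameter $c\in\mathbb R$: Player A chooses a CDF $F_x\in\mathcal F_a$, the set of CDFs of nonnegative random variables $X$ with $\mathbb E[X]=a$; Player B chooses $F_y\in\mathcal F_b$, the set of CDFs of nonnegative random variables $Y$ with $\mathbb E[Y]=b$. With $X\sim F_x$, $Y\sim F_y$ independent, the payoffs are $\Pi_A(F_x,F_y;c)=\mathbb P(X\ge c+Y)$ and $\Pi_B=1-\Pi_A$. The pair $(\bar F_x^c,\bar F_y^c)$ denotes the Nash equilibrium (NE) of this subgame, i.e. $\Pi_A(F_x,\bar F_y^c;c)\le\Pi_A(\bar F_x^c,\bar F_y^c;c)$ for all $F_x\in\mathcal F_a$ and $\Pi_B(\bar F_x^c,F_y;c)\le\Pi_B(\bar F_x^c,\bar F_y^c;c)$ for all $F_y\in\mathcal F_b$. It is a known result that this NE is given as follows. Let $\delta_z$ be the Dirac distribution at $z$, $U(\ell,r)$ the uniform distribution on $[\ell,r]$, and $r_0=a-\frac{b+\sqrt{b^2+8ab}}{4}$. Put $d=\frac{b+\sqrt{b^2+2cb}}{2}$ if $c\ge r_0$; $d=a-c$ if $0\le c<r_0$; $d=\frac{a+\sqrt{a^2-2ca}}{2}$ if $c<0$. If $c\ge0$: $\bar F_x^c\sim(1-\frac{a}{c+d})\delta_0+\frac{a}{c+d}U(c,c+2d)$, $\bar F_y^c\sim(1-\frac bd)\delta_0+\frac bd U(0,2d)$. If $c<0$: $\bar F_x^c\sim(1-\frac ad)\delta_0+\frac ad U(0,2d)$, $\bar F_y^c\sim(1-\frac{b}{d-c})\delta_0+\frac{b}{d-c}U(-c,-c+2d)$.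 R-Lotto game: the regulator, Player C, first chooses $c\in\mathcal C$, then A and B play the subgame with parameter $c$. Player C's payoff is $\Pi_C(F_x,F_y;c)=w_A\Pi_A(F_x,F_y;c)+w_B\Pi_B(F_x,F_y;c)-H(|c|)$. Nash--Stackelberg equilibrium (NSE): a triple $(F_x^*,F_y^*;c^* )\in\mathcal F_a\times\mathcal F_b\times\mathcal C$ such that $(F_x^*,F_y^* )=(\bar F_x^{c^*},\bar F_y^{c^*})$ and $\Pi_C(\bar F_x^c,\bar F_y^c;c)\le\Pi_C(F_x^*,F_y^*;c^* )$ for all $c\in\mathcal C$. *)

theory Defs
  imports "HOL-Probability.Probability"
begin

text \<open>A CDF on the reals is identified with the Borel probability measure it determines
  (a bijection, see \<open>cdf_unique\<close> and \<open>real_distribution_interval_measure\<close>).\<close>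

definition strategies :: "real \<Rightarrow> real measure set" where
  "strategies m = {M. real_distribution M \<and> (AE x in M. 0 \<le> x) \<and>
     integrable M (\<lambda>x. x) \<and> (\<integral>x. x \<partial>M) = m}"

definition payoff_A :: "real \<Rightarrow> real measure \<Rightarrow> real measure \<Rightarrow> real" where
  "payoff_A c Fx Fy = measure (Fx \<Otimes>\<^sub>M Fy) {(x, y). x \<ge> c + y}"

definition payoff_B :: "real \<Rightarrow> real measure \<Rightarrow> real measure \<Rightarrow> real" where
  "payoff_B c Fx Fy = 1 - payoff_A c Fx Fy"

definition followers_NE :: "real \<Rightarrow> real \<Rightarrow> real \<Rightarrow> real measure \<Rightarrow> real measure \<Rightarrow> bool" where
  "followers_NE a b c Fx Fy \<longleftrightarrow>
     Fx \<in> strategies a \<and> Fy \<in> strategies b \<and>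
     (\<forall>Gx\<in>strategies a. payoff_A c Gx Fy \<le> payoff_A c Fx Fy) \<and>
     (\<forall>Gy\<in>strategies b. payoff_B c Fx Gy \<le> payoff_B c Fx Fy)"

text \<open>For \<open>a \<ge> b > 0\<close> the equilibrium exists and is unique, so the description is proper;
  see \<open>followers_NE_iff\<close> and \<open>NE_pair_eq\<close> below, which also give the closed form.\<close>

definition NE_pair :: "real \<Rightarrow> real \<Rightarrow> real \<Rightarrow> real measure \<times> real measure" where
  "NE_pair a b c = (THE (Fx, Fy). followers_NE a b c Fx Fy)"

definition NE_payoff_A :: "real \<Rightarrow> real \<Rightarrow> real \<Rightarrow> real" where
  "NE_payoff_A a b c = (case NE_pair a b c of (Fx, Fy) \<Rightarrow> payoff_A c Fx Fy)"

definition payoff_C ::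
  "real \<Rightarrow> real \<Rightarrow> (real \<Rightarrow> real) \<Rightarrow> real \<Rightarrow> real measure \<Rightarrow> real measure \<Rightarrow> real" where
  "payoff_C wA wB H c Fx Fy = wA * payoff_A c Fx Fy + wB * payoff_B c Fx Fy - H \<bar>c\<bar>"

definition is_NSE ::
  "real \<Rightarrow> real \<Rightarrow> real \<Rightarrow> real \<Rightarrow> (real \<Rightarrow> real) \<Rightarrow> real set \<Rightarrow>
   real measure \<Rightarrow> real measure \<Rightarrow> real \<Rightarrow> bool" where
  "is_NSE a b wA wB H C Fx Fy c \<longleftrightarrow>
     Fx \<in> strategies a \<and> Fy \<in> strategies b \<and> c \<in> C \<and>
     (Fx, Fy) = NE_pair a b c \<and>
     (\<forall>c'\<in>C. (case NE_pair a b c' of (Gx, Gy) \<Rightarrow> payoff_C wA wB H c' Gx Gy)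
        \<le> payoff_C wA wB H c Fx Fy)"

definition NSE_intervention ::
  "real \<Rightarrow> real \<Rightarrow> real \<Rightarrow> real \<Rightarrow> (real \<Rightarrow> real) \<Rightarrow> real set \<Rightarrow> real \<Rightarrow> bool" where
  "NSE_intervention a b wA wB H C c \<longleftrightarrow> (\<exists>Fx Fy. is_NSE a b wA wB H C Fx Fy c)"

section \<open>The closed form of the followers' equilibrium\<close>

text \<open>\<open>mixture p M N\<close> is the distribution \<open>p M + (1 - p) N\<close>.\<close>

definition mixture :: "real \<Rightarrow> real measure \<Rightarrow> real measure \<Rightarrow> real measure" where
  "mixture p M N = measure_pmf (bernoulli_pmf p) \<bind> (\<lambda>s. if s then M else N)"

definition NE_r0 :: "real \<Rightarrow> real \<Rightarrow> real" where
  "NE_r0 a b = a - (b + sqrt (b\<^sup>2 + 8 * a * b)) / 4"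

definition NE_d :: "real \<Rightarrow> real \<Rightarrow> real \<Rightarrow> real" where
  "NE_d a b c =
     (if c \<ge> NE_r0 a b then (b + sqrt (b\<^sup>2 + 2 * c * b)) / 2
      else if 0 \<le> c then a - c
      else (a + sqrt (a\<^sup>2 - 2 * c * a)) / 2)"

definition NE_X :: "real \<Rightarrow> real \<Rightarrow> real \<Rightarrow> real measure" where
  "NE_X a b c = (let d = NE_d a b c in
     if c \<ge> 0 then mixture (a / (c + d)) (uniform_measure lborel {c..c + 2 * d}) (return borel 0)
     else mixture (a / d) (uniform_measure lborel {0..2 * d}) (return borel 0))"

definition NE_Y :: "real \<Rightarrow> real \<Rightarrow> real \<Rightarrow> real measure" where
  "NE_Y a b c = (let d = NE_d a b c in
     if c \<ge> 0 then mixture (b / d) (uniform_measure lborel {0..2 * d}) (return borel 0)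
     else mixture (b / (d - c)) (uniform_measure lborel {-c..-c + 2 * d}) (return borel 0))"

section \<open>Strategies and mixtures\<close>

lemma strategiesD:
  assumes "M \<in> strategies m"
  shows "real_distribution M" "AE x in M. 0 \<le> x" "integrable M (\<lambda>x. x)" "(\<integral>x. x \<partial>M) = m"
  using assms by (auto simp: strategies_def)

lemma real_distribution_return: "real_distribution (return borel (s::real))"
  by (simp add: real_distribution_def real_distribution_axioms_def prob_space_return)

lemma real_distribution_uniform:
  assumes "l < (r::real)" shows "real_distribution (uniform_measure lborel {l..r})"
  unfolding real_distribution_def real_distribution_axioms_def
  using assms by (auto intro!: prob_space_uniform_measure)

lemma mixture_measurable:
  assumes "real_distribution M" "real_distribution N"
  shows "(\<lambda>s. if s then M else N) \<in> measure_pmf (bernoulli_pmf p) \<rightarrow>\<^sub>M subprob_algebra borel"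
proof -
  interpret M: real_distribution M by fact
  interpret N: real_distribution N by fact
  show ?thesis
    by (auto simp: space_subprob_algebra M.subprob_space_axioms N.subprob_space_axioms
        M.prob_space_axioms N.prob_space_axioms prob_space_imp_subprob_space)
qed

lemma nn_integral_mixture:
  assumes "real_distribution M" "real_distribution N" "p \<in> {0..1}" "f \<in> borel_measurable borel"
  shows "(\<integral>\<^sup>+x. f x \<partial>mixture p M N) = ennreal p * (\<integral>\<^sup>+x. f x \<partial>M) + ennreal (1 - p) * (\<integral>\<^sup>+x. f x \<partial>N)"
  unfolding mixture_def using assms
  by (subst nn_integral_bind[OF _ mixture_measurable]) (auto simp: mult.commute)

lemma real_distribution_mixture:
  assumes "real_distribution M" "real_distribution N" "p \<in> {0..1}"
  shows "real_distribution (mixture p M N)"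
proof -
  have s: "sets (mixture p M N) = sets borel"
    unfolding mixture_def
    by (rule sets_bind[where N=borel])
      (use assms in \<open>auto simp: real_distribution_def real_distribution_axioms_def\<close>)
  have sp: "space (mixture p M N) = UNIV" using sets_eq_imp_space_eq[OF s] by simp
  interpret M: real_distribution M by fact
  interpret N: real_distribution N by fact
  have "emeasure (mixture p M N) UNIV = (\<integral>\<^sup>+x. 1 \<partial>mixture p M N)" using sp by simp
  also have "\<dots> = ennreal p + ennreal (1 - p)"
    using M.emeasure_space_1 N.emeasure_space_1 assms by (subst nn_integral_mixture) auto
  also have "\<dots> = 1" using assms by (simp flip: ennreal_plus)
  finally show ?thesis
    using s sp by (auto simp: real_distribution_def real_distribution_axioms_def intro!: prob_spaceI)
qed

lemma emeasure_mixture: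
  assumes "real_distribution M" "real_distribution N" "p \<in> {0..1}" "A \<in> sets borel"
  shows "emeasure (mixture p M N) A = ennreal p * emeasure M A + ennreal (1 - p) * emeasure N A"
proof -
  interpret M: real_distribution M by fact
  interpret N: real_distribution N by fact
  interpret X: real_distribution "mixture p M N" by (rule real_distribution_mixture) fact+
  show ?thesis
    using nn_integral_mixture[OF assms(1-3), of "indicator A"] assms by simp
qed

lemma measure_mixture:
  assumes "real_distribution M" "real_distribution N" "p \<in> {0..1}" "A \<in> sets borel"
  shows "measure (mixture p M N) A = p * measure M A + (1 - p) * measure N A"
proof -
  interpret M: real_distribution M by fact
  interpret N: real_distribution N by fact
  interpret X: real_distribution "mixture p M N" by (rule real_distribution_mixture) fact+
  have "ennreal (measure (mixture p M N) A) = ennreal (p * measure M A + (1 - p) * measure N A)"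
    using emeasure_mixture[OF assms] assms(3)
    by (simp add: X.emeasure_eq_measure M.emeasure_eq_measure N.emeasure_eq_measure
        ennreal_mult ennreal_plus)
  then show ?thesis using assms(3) by (subst (asm) ennreal_inj) auto
qed

lemma integral_mixture:
  assumes "real_distribution M" "real_distribution N" "p \<in> {0..1}"
    "f \<in> borel_measurable borel" "\<And>x. 0 \<le> f x" "\<And>x. f x \<le> (1::real)"
  shows "(\<integral>x. f x \<partial>mixture p M N) = p * (\<integral>x. f x \<partial>M) + (1 - p) * (\<integral>x. f x \<partial>N)"
proof -
  interpret M: real_distribution M by fact
  interpret N: real_distribution N by fact
  interpret X: real_distribution "mixture p M N" by (rule real_distribution_mixture) fact+
  have i: "integrable K f" if "real_distribution K" for K
  proof -
    interpret K: real_distribution K by fact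
    show ?thesis by (rule K.integrable_const_bound[where B=1]) (use assms in auto)
  qed
  have "ennreal (\<integral>x. f x \<partial>mixture p M N) = ennreal (p * (\<integral>x. f x \<partial>M) + (1 - p) * (\<integral>x. f x \<partial>N))"
    using nn_integral_mixture[OF assms(1-3), of "\<lambda>x. ennreal (f x)"] assms(3-6)
    by (simp add: nn_integral_eq_integral i M.real_distribution_axioms N.real_distribution_axioms
        X.real_distribution_axioms ennreal_mult ennreal_plus integral_nonneg)
  then show ?thesis using assms(3,5) by (subst (asm) ennreal_inj) auto
qed

lemma AE_mixture_return:
  assumes "real_distribution M" "p \<in> {0..1}" "{x. P x} \<in> sets borel"
  shows "(AE x in mixture p M (return borel s). P x) \<longleftrightarrow> (p = 0 \<or> (AE x in M. P x)) \<and> (p = 1 \<or> P s)"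
proof -
  note R = real_distribution_return
  interpret M: real_distribution M by fact
  interpret X: real_distribution "mixture p M (return borel s)"
    by (rule real_distribution_mixture[OF assms(1) R assms(2)])
  have m: "{x. \<not> P x} \<in> sets borel" using borel_comp[OF assms(3)] by (simp add: Collect_neg_eq)
  have "(AE x in mixture p M (return borel s). P x) \<longleftrightarrow>
      emeasure (mixture p M (return borel s)) {x. \<not> P x} = 0"
    using m by (subst AE_iff_measurable[OF _ refl]) auto
  also have "\<dots> \<longleftrightarrow> (p = 0 \<or> emeasure M {x. \<not> P x} = 0) \<and> (p = 1 \<or> P s)"
    using assms(2) m
    by (subst emeasure_mixture[OF assms(1) R assms(2) m])
      (auto simp: add_eq_0_iff_both_eq_0 indicator_def ennreal_eq_0_iff)
  also have "emeasure M {x. \<not> P x} = 0 \<longleftrightarrow> (AE x in M. P x)"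
    using m by (subst AE_iff_measurable[OF _ refl]) auto
  finally show ?thesis .
qed

lemma strategiesI_nn:
  assumes "real_distribution M" "AE x in M. 0 \<le> x" "(\<integral>\<^sup>+x. ennreal x \<partial>M) = ennreal m" "0 \<le> m"
  shows "M \<in> strategies m"
proof -
  interpret M: real_distribution M by fact
  have "integrable M (\<lambda>x. x) \<and> integral\<^sup>L M (\<lambda>x. x) = m"
    using assms by (subst nn_integral_eq_integrable[symmetric]) auto
  then show ?thesis using assms by (auto simp: strategies_def)
qed

lemma nn_of_strategies:
  assumes "M \<in> strategies m"
  shows "(\<integral>\<^sup>+x. ennreal x \<partial>M) = ennreal m"
  using strategiesD[OF assms] by (simp add: nn_integral_eq_integral)

lemma strategies_nonneg: "M \<in> strategies m \<Longrightarrow> 0 \<le> m"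
  using strategiesD[of M m] by (auto dest: integral_nonneg_AE)

lemma mixture_strategies:
  assumes M: "M \<in> strategies k" and N: "N \<in> strategies l" and p: "p \<in> {0..1}"
  shows "mixture p M N \<in> strategies (p * k + (1 - p) * l)"
proof (rule strategiesI_nn)
  note k = strategies_nonneg[OF M] and l = strategies_nonneg[OF N]
  note rM = strategiesD(1)[OF M] and rN = strategiesD(1)[OF N]
  show rd: "real_distribution (mixture p M N)" by (rule real_distribution_mixture[OF rM rN p])
  interpret M: real_distribution M by fact
  interpret N: real_distribution N by fact
  interpret X: real_distribution "mixture p M N" by fact
  have "{x::real. \<not> 0 \<le> x} = {..<0}" by auto
  then have m: "{x::real. \<not> 0 \<le> x} \<in> sets borel" by simp
  have "emeasure M {x. \<not> 0 \<le> x} = 0" "emeasure N {x. \<not> 0 \<le> x} = 0"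
    using strategiesD(2)[OF M] strategiesD(2)[OF N] m
      AE_iff_measurable[of "{x. \<not> 0 \<le> x}" M "\<lambda>x. 0 \<le> x"]
      AE_iff_measurable[of "{x. \<not> 0 \<le> x}" N "\<lambda>x. 0 \<le> x"] by auto
  then have "emeasure (mixture p M N) {x. \<not> 0 \<le> x} = 0"
    by (simp add: emeasure_mixture[OF rM rN p m])
  then show "AE x in mixture p M N. 0 \<le> x"
    using m by (subst AE_iff_measurable[OF _ refl]) auto
  show "(\<integral>\<^sup>+x. ennreal x \<partial>mixture p M N) = ennreal (p * k + (1 - p) * l)"
    using p k l by (subst nn_integral_mixture[OF rM rN p])
      (auto simp: nn_of_strategies[OF M] nn_of_strategies[OF N] ennreal_mult ennreal_plus)
  show "0 \<le> p * k + (1 - p) * l" using p k l by auto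
qed

lemma return_strategies: "0 \<le> s \<Longrightarrow> return borel s \<in> strategies s"
  by (rule strategiesI_nn) (auto simp: real_distribution_return AE_return nn_integral_return)

lemma uniform_strategies:
  assumes "0 \<le> l" "l < (r::real)"
  shows "uniform_measure lborel {l..r} \<in> strategies ((l + r) / 2)"
proof -
  let ?U = "uniform_measure lborel {l..r}"
  interpret U: real_distribution ?U by (rule real_distribution_uniform) fact
  have ae: "AE x in ?U. 0 \<le> x" by (rule AE_uniform_measureI) (use assms in auto)
  have D: "distributed ?U lborel (\<lambda>x. x) (\<lambda>x. indicator {l..r} x / measure lborel {l..r})"
    unfolding U.uniform_distributed_iff
  proof (intro conjI ballI)
    fix t assume t: "t \<in> {l..r}"
    have "{l..r} \<inter> {..t} = {l..t}" using t by auto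
    then show "measure ?U {x \<in> space ?U. x \<le> t} = (t - l) / (r - l)"
      using t assms by (simp add: measure_uniform_measure atMost_def[symmetric])
  qed (use assms in auto)
  have e: "(\<integral>x. x \<partial>?U) = (l + r) / 2" by (rule U.uniform_distributed_expectation[OF D])
  have b: "AE x in ?U. norm x \<le> r" by (rule AE_uniform_measureI) (use assms in auto)
  have "integrable ?U (\<lambda>x. x)"
    by (rule U.integrable_const_bound[OF b]) auto
  with ae e show ?thesis using U.real_distribution_axioms by (auto simp: strategies_def)
qed

lemma measure_uniform_atMost:
  assumes "l < (r::real)"
  shows "measure (uniform_measure lborel {l..r}) {..t} = max 0 (min 1 ((t - l) / (r - l)))"
proof -
  have e: "{l..r} \<inter> {..t} = {l..min r t}" by auto
  show ?thesis
    using assms by (subst measure_uniform_measure) (auto simp: e min_def max_def field_simps)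
qed

lemma measure_uniform_atLeast:
  assumes "l < (r::real)"
  shows "measure (uniform_measure lborel {l..r}) {t..} = max 0 (min 1 ((r - t) / (r - l)))"
proof -
  have e: "{l..r} \<inter> {t..} = {max l t..r}" by auto
  show ?thesis
    using assms by (subst measure_uniform_measure) (auto simp: e min_def max_def field_simps)
qed

section \<open>Payoffs as integrals\<close>

lemma winning_set: "{(x, y). x \<ge> c + (y::real)} \<in> sets (borel \<Otimes>\<^sub>M borel)"
proof -
  have "{p \<in> space (borel \<Otimes>\<^sub>M borel). c + snd p \<le> fst p} \<in> sets (borel \<Otimes>\<^sub>M (borel :: real measure))"
    by measurable
  then show ?thesis by (simp add: space_pair_measure case_prod_beta')
qed

lemma cdf_measurable:
  assumes "real_distribution Y" shows "(\<lambda>x. cdf Y (x - c)) \<in> borel_measurable borel"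
proof -
  interpret Y: real_distribution Y by fact
  show ?thesis by (rule borel_measurable_mono) (auto intro!: monoI Y.cdf_nondecreasing)
qed

lemma tail_measurable:
  assumes "real_distribution X" shows "(\<lambda>y. measure X {c + y..}) \<in> borel_measurable borel"
proof -
  interpret X: real_distribution X by fact
  have "(\<lambda>y. - measure X {c + y..}) \<in> borel_measurable borel"
    by (rule borel_measurable_mono) (auto intro!: monoI X.finite_measure_mono)
  then show ?thesis by simp
qed

lemma
  assumes "real_distribution X" "real_distribution Y"
  shows payoff_cdf: "payoff_A c X Y = (\<integral>x. cdf Y (x - c) \<partial>X)"
    and payoff_tail: "payoff_A c X Y = (\<integral>y. measure X {c + y..} \<partial>Y)"
proof -
  interpret X: real_distribution X by fact
  interpret Y: real_distribution Y by fact
  interpret XY: pair_prob_space X Y ..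
  let ?W = "{(x, y). x \<ge> c + (y::real)}"
  have W: "?W \<in> sets (X \<Otimes>\<^sub>M Y)" using winning_set[of c] by simp
  have e1: "{y. c + y \<le> x} = {..x - c}" for x by auto
  have e2: "{x. c + y \<le> x} = {c + y..}" for y by auto
  have iX: "integrable X (\<lambda>x. cdf Y (x - c))"
    by (rule X.integrable_const_bound[where B=1])
      (auto simp: Y.cdf_nonneg Y.cdf_bounded_prob cdf_measurable[OF assms(2)])
  have iY: "integrable Y (\<lambda>y. measure X {c + y..})"
    by (rule Y.integrable_const_bound[where B=1])
      (auto simp: tail_measurable[OF assms(1)])
  have "ennreal (payoff_A c X Y) = emeasure (X \<Otimes>\<^sub>M Y) ?W"
    by (simp add: payoff_A_def XY.P.emeasure_eq_measure)
  also have "\<dots> = (\<integral>\<^sup>+x. ennreal (cdf Y (x - c)) \<partial>X)"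
    by (subst Y.emeasure_pair_measure_alt[OF W]) (simp add: e1 Y.emeasure_eq_measure cdf_def)
  also have "\<dots> = ennreal (\<integral>x. cdf Y (x - c) \<partial>X)"
    by (rule nn_integral_eq_integral[OF iX]) (simp add: Y.cdf_nonneg)
  finally show "payoff_A c X Y = (\<integral>x. cdf Y (x - c) \<partial>X)"
    by (subst (asm) ennreal_inj) (auto simp: payoff_A_def Y.cdf_nonneg)
  have "ennreal (payoff_A c X Y) = emeasure (X \<Otimes>\<^sub>M Y) ?W"
    by (simp add: payoff_A_def XY.P.emeasure_eq_measure)
  also have "\<dots> = (\<integral>\<^sup>+y. ennreal (measure X {c + y..}) \<partial>Y)"
    by (subst XY.emeasure_pair_measure_alt2[OF W]) (simp add: e2 X.emeasure_eq_measure)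
  also have "\<dots> = ennreal (\<integral>y. measure X {c + y..} \<partial>Y)"
    by (rule nn_integral_eq_integral[OF iY]) simp
  finally show "payoff_A c X Y = (\<integral>y. measure X {c + y..} \<partial>Y)"
    by (subst (asm) ennreal_inj) (auto simp: payoff_A_def)
qed

text \<open>A strategy that is optimal against every opponent has an affine supporting bound.\<close>

lemma affine_bound:
  fixes h :: "real \<Rightarrow> real"
  assumes "0 < m" and mid: "V \<le> h m"
    and two: "\<And>s t. 0 \<le> s \<Longrightarrow> s < m \<Longrightarrow> m < t \<Longrightarrow>
      V \<le> (t - m) / (t - s) * h s + (m - s) / (t - s) * h t"
  shows "\<exists>\<mu>. \<forall>y\<ge>0. V - \<mu> * (y - m) \<le> h y"
proof -
  define S where "S = (\<lambda>t. (V - h t) / (t - m)) ` {m<..}"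
  have le: "(V - h t) / (t - m) \<le> (h s - V) / (m - s)" if "0 \<le> s" "s < m" "m < t" for s t
  proof -
    have "V * (t - s) \<le> ((t - m) / (t - s) * h s + (m - s) / (t - s) * h t) * (t - s)"
      using two[OF that] that by (intro mult_right_mono) auto
    also have "\<dots> = (t - m) * h s + (m - s) * h t"
      using that by (simp add: distrib_right)
    finally have "(V - h t) * (m - s) \<le> (h s - V) * (t - m)" by (simp add: algebra_simps)
    then show ?thesis using that by (simp add: field_simps)
  qed
  have bdd: "bdd_above S" unfolding S_def bdd_above_def
    by (rule exI[of _ "(h 0 - V) / (m - 0)"]) (use le[of 0] assms(1) in auto)
  have ne: "S \<noteq> {}" unfolding S_def by auto
  show ?thesis
  proof (intro exI[of _ "Sup S"] allI impI)
    fix y :: real assume y: "0 \<le> y"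
    consider "y < m" | "y = m" | "y > m" by linarith
    then show "V - Sup S * (y - m) \<le> h y"
    proof cases
      case 1
      have "Sup S \<le> (h y - V) / (m - y)"
        by (rule cSup_least[OF ne]) (use le[OF y 1] in \<open>auto simp: S_def\<close>)
      then have "Sup S * (m - y) \<le> h y - V" using 1 by (simp add: field_simps)
      then show ?thesis by (simp add: algebra_simps)
    next
      case 3
      have "(V - h y) / (y - m) \<le> Sup S"
        by (rule cSup_upper[OF _ bdd]) (use 3 in \<open>auto simp: S_def\<close>)
      then have "V - h y \<le> Sup S * (y - m)" using 3 by (simp add: field_simps)
      then show ?thesis by simp
    qed (use mid in simp)
  qed
qed

lemma two_point_strategy:
  assumes "0 \<le> s" "s < m" "m < (t::real)"
  shows "mixture ((t - m) / (t - s)) (return borel s) (return borel t) \<in> strategies m"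
proof -
  have p: "(t - m) / (t - s) \<in> {0..1}" using assms by auto
  have e: "(t - m) / (t - s) * s + (1 - (t - m) / (t - s)) * t = m"
    using assms by (simp add: divide_simps) (simp add: algebra_simps)
  show ?thesis
    using mixture_strategies[OF return_strategies return_strategies p, of s t] assms e by auto
qed

lemma integral_two_point:
  assumes "0 \<le> s" "s < m" "m < (t::real)"
    "f \<in> borel_measurable borel" "\<And>x. 0 \<le> f x" "\<And>x. f x \<le> (1::real)"
  shows "(\<integral>x. f x \<partial>mixture ((t - m) / (t - s)) (return borel s) (return borel t)) =
    (t - m) / (t - s) * f s + (m - s) / (t - s) * f t"
proof -
  have p: "(t - m) / (t - s) \<in> {0..1}" using assms by auto
  have e: "1 - (t - m) / (t - s) = (m - s) / (t - s)" using assms by (simp add: field_simps)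
  show ?thesis
    using integral_mixture[OF real_distribution_return real_distribution_return p assms(4-6), of s t]
      assms(4) by (simp add: integral_return e)
qed

lemma affine_bound_X:
  assumes X: "real_distribution X" and "0 < b"
    and opt: "\<And>Y. Y \<in> strategies b \<Longrightarrow> V \<le> payoff_A c X Y"
  shows "\<exists>\<mu>. \<forall>y\<ge>0. V - \<mu> * (y - b) \<le> measure X {c + y..}"
proof (rule affine_bound[OF \<open>0 < b\<close>])
  interpret X: real_distribution X by fact
  note m = tail_measurable[OF X, of c]
  show "V \<le> measure X {c + b..}"
    using opt[OF return_strategies[of b]] \<open>0 < b\<close> m
    by (simp add: payoff_tail[OF X real_distribution_return] integral_return)
  fix s t :: real assume st: "0 \<le> s" "s < b" "b < t"
  show "V \<le> (t - b) / (t - s) * measure X {c + s..} + (b - s) / (t - s) * measure X {c + t..}"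
    using opt[OF two_point_strategy[OF st]]
    by (simp add: payoff_tail[OF X strategiesD(1)[OF two_point_strategy[OF st]]]
        integral_two_point[OF st m])
qed

lemma affine_bound_Y:
  assumes Y: "real_distribution Y" and "0 < a"
    and opt: "\<And>X. X \<in> strategies a \<Longrightarrow> payoff_A c X Y \<le> V"
  shows "\<exists>\<mu>. \<forall>x\<ge>0. cdf Y (x - c) \<le> V + \<mu> * (x - a)"
proof -
  interpret Y: real_distribution Y by fact
  note m = cdf_measurable[OF Y, of c]
  have "\<exists>\<mu>. \<forall>x\<ge>0. (- V) - \<mu> * (x - a) \<le> - cdf Y (x - c)"
  proof (rule affine_bound[OF \<open>0 < a\<close>])
    show "- V \<le> - cdf Y (a - c)"
      using opt[OF return_strategies[of a]] \<open>0 < a\<close> m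
      by (simp add: payoff_cdf[OF real_distribution_return Y] integral_return)
    fix s t :: real assume st: "0 \<le> s" "s < a" "a < t"
    show "- V \<le> (t - a) / (t - s) * - cdf Y (s - c) + (a - s) / (t - s) * - cdf Y (t - c)"
      using opt[OF two_point_strategy[OF st]]
      by (simp add: payoff_cdf[OF strategiesD(1)[OF two_point_strategy[OF st]] Y]
        integral_two_point[OF st m] Y.cdf_nonneg Y.cdf_bounded_prob)
  qed
  then obtain \<mu> where "\<forall>x\<ge>0. (- V) - \<mu> * (x - a) \<le> - cdf Y (x - c)" by blast
  then have "\<forall>x\<ge>0. cdf Y (x - c) \<le> V + \<mu> * (x - a)" by (auto simp: algebra_simps)
  then show ?thesis by blast
qed

lemma AE_eq_of_le_integral_eq:
  fixes f g :: "real \<Rightarrow> real"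
  assumes "integrable M f" "integrable M g" "AE x in M. f x \<le> g x" "(\<integral>x. f x \<partial>M) = (\<integral>x. g x \<partial>M)"
  shows "AE x in M. f x = g x"
proof -
  have "(\<integral>x. g x - f x \<partial>M) = 0" using assms by simp
  then have "AE x in M. g x - f x = 0"
    using assms by (subst (asm) integral_nonneg_eq_0_iff_AE) auto
  then show ?thesis by auto
qed

lemma AE_interval_dense:
  assumes ae: "AE x in uniform_measure lborel {l..r}. P x" and P: "{x. P x} \<in> sets borel"
    and "l < r" "l \<le> u" "u < v" "v \<le> (r::real)"
  shows "\<exists>z. u < z \<and> z < v \<and> P z"
proof (rule ccontr)
  assume "\<not> ?thesis"
  then have sub: "{u<..<v} \<subseteq> {x. \<not> P x}" by auto
  have m: "{x. \<not> P x} \<in> sets borel" using borel_comp[OF P] by (simp add: Collect_neg_eq)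
  interpret U: real_distribution "uniform_measure lborel {l..r}"
    by (rule real_distribution_uniform) fact
  have "emeasure (uniform_measure lborel {l..r}) {x. \<not> P x} = 0"
    using ae m by (subst (asm) AE_iff_measurable[OF _ refl]) auto
  then have "measure (uniform_measure lborel {l..r}) {x. \<not> P x} = 0"
    by (simp add: measure_def)
  moreover have "measure (uniform_measure lborel {l..r}) {u<..<v} \<le> measure (uniform_measure lborel {l..r}) {x. \<not> P x}"
    using sub m by (intro U.finite_measure_mono) auto
  moreover have "{l..r} \<inter> {u<..<v} = {u<..<v}" using assms by auto
  then have "measure (uniform_measure lborel {l..r}) {u<..<v} = (v - u) / (r - l)"
    using assms by (subst measure_uniform_measure) auto
  moreover have "(v - u) / (r - l) > 0" using assms by simp
  ultimately show False by linarith
qed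

section \<open>Saddle point and uniqueness\<close>

text \<open>Both sign cases of \<open>c\<close> at once: the continuous parts live on \<open>[m, m + 2d]\<close> and
  \<open>[n, n + 2d]\<close> with \<open>m = max 0 c\<close>, \<open>n = max 0 (-c)\<close>.\<close>

locale lotto_saddle =
  fixes a b c d m n p q :: real and LX LY :: "real \<Rightarrow> real"
  assumes a: "0 < a" and b: "0 < b" and d: "0 < d"
    and m_def: "m = max 0 c" and n_def: "n = max 0 (- c)"
    and p_def: "p = a / (m + d)" and q_def: "q = b / (n + d)"
    and p1: "p \<le> 1" and q1: "q \<le> 1"
    and LX_def: "LX = (\<lambda>x. 1 - q + q * (x - m) / (2 * d))"
    and LY_def: "LY = (\<lambda>y. p * (n + 2 * d - y) / (2 * d))"
    and cpos: "0 < c \<Longrightarrow> q < 1 \<and> 0 \<le> LX 0 \<and> (p = 1 \<or> LX 0 = 0)"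
    and cneg: "c < 0 \<Longrightarrow> p < 1 \<and> LY 0 = 1"
    and czero: "c = 0 \<Longrightarrow> p = 1"
begin

definition "bX = mixture p (uniform_measure lborel {m..m + 2 * d}) (return borel 0)"
definition "bY = mixture q (uniform_measure lborel {n..n + 2 * d}) (return borel 0)"

lemma mn: "0 \<le> m" "0 \<le> n" "c = m - n" by (auto simp: m_def n_def)

lemma p0: "0 < p" and q0: "0 < q" using a b d mn by (auto simp: p_def q_def)

lemma pq: "p \<in> {0..1}" "q \<in> {0..1}" using p0 q0 p1 q1 by auto

lemma rU: "real_distribution (uniform_measure lborel {m..m + 2 * d})"
  "real_distribution (uniform_measure lborel {n..n + 2 * d})"
  using d by (auto intro!: real_distribution_uniform)

lemma bX_strategy: "bX \<in> strategies a" and bY_strategy: "bY \<in> strategies b"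
proof -
  have "uniform_measure lborel {m..m + 2 * d} \<in> strategies ((m + (m + 2 * d)) / 2)"
    by (rule uniform_strategies) (use d mn in auto)
  from mixture_strategies[OF this return_strategies[OF order_refl] pq(1)]
  have "bX \<in> strategies (p * ((m + (m + 2 * d)) / 2) + (1 - p) * 0)" unfolding bX_def .
  moreover have "p * ((m + (m + 2 * d)) / 2) + (1 - p) * 0 = p * (m + d)" by simp
  moreover have "p * (m + d) = a" using d mn by (simp add: p_def)
  ultimately show "bX \<in> strategies a" by simp
  have "uniform_measure lborel {n..n + 2 * d} \<in> strategies ((n + (n + 2 * d)) / 2)"
    by (rule uniform_strategies) (use d mn in auto)
  from mixture_strategies[OF this return_strategies[OF order_refl] pq(2)]
  have "bY \<in> strategies (q * ((n + (n + 2 * d)) / 2) + (1 - q) * 0)" unfolding bY_def .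
  moreover have "q * ((n + (n + 2 * d)) / 2) + (1 - q) * 0 = q * (n + d)" by simp
  moreover have "q * (n + d) = b" using d mn by (simp add: q_def)
  ultimately show "bY \<in> strategies b" by simp
qed

lemma cdf_bY: "cdf bY t = q * max 0 (min 1 ((t - n) / (2 * d))) + (1 - q) * (if 0 \<le> t then 1 else 0)"
proof -
  have e: "measure (uniform_measure lborel {n..n + 2 * d}) {..t} = max 0 (min 1 ((t - n) / (2 * d)))"
    using measure_uniform_atMost[of n "n + 2 * d" t] d by (simp only:) simp
  show ?thesis
    unfolding bY_def cdf_def measure_mixture[OF rU(2) real_distribution_return pq(2) atMost_borel] e
    by (simp add: measure_return indicator_def)
qed

lemma tail_bX: "measure bX {t..} = p * max 0 (min 1 ((m + 2 * d - t) / (2 * d))) + (1 - p) * (if t \<le> 0 then 1 else 0)"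
proof -
  have e: "measure (uniform_measure lborel {m..m + 2 * d}) {t..} = max 0 (min 1 ((m + 2 * d - t) / (2 * d)))"
    using measure_uniform_atLeast[of m "m + 2 * d" t] d by (simp only:) simp
  show ?thesis
    unfolding bX_def measure_mixture[OF rU(1) real_distribution_return pq(1) atLeast_borel] e
    by (simp add: measure_return indicator_def)
qed

lemma LX_mono: "x < y \<Longrightarrow> LX x < LX y"
  using q0 d by (auto simp: LX_def divide_strict_right_mono)

lemma LY_mono: "x < y \<Longrightarrow> LY y < LY x"
  using p0 d by (auto simp: LY_def divide_strict_right_mono)

lemma LX_top: "LX (m + 2 * d) = 1" and LX_bot: "LX m = 1 - q"
  and LY_top: "LY (n + 2 * d) = 0" and LY_bot: "LY n = p"
  using d by (auto simp: LX_def LY_def)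

lemma cdf_bY_mid: "m \<le> x \<Longrightarrow> x \<le> m + 2 * d \<Longrightarrow> cdf bY (x - c) = LX x"
proof -
  assume x: "m \<le> x" "x \<le> m + 2 * d"
  have e: "x - c - n = x - m" using mn by simp
  have "0 \<le> (x - m) / (2 * d)" "(x - m) / (2 * d) \<le> 1" using x d by auto
  moreover have "0 \<le> x - c" using x mn by simp
  ultimately show ?thesis by (simp add: cdf_bY e LX_def)
qed

lemma cdf_bY_high: "m + 2 * d \<le> x \<Longrightarrow> cdf bY (x - c) = 1"
proof -
  assume x: "m + 2 * d \<le> x"
  have e: "x - c - n = x - m" using mn by simp
  have "1 \<le> (x - m) / (2 * d)" using x d by auto
  moreover have "0 \<le> x - c" using x mn d by simp
  ultimately show ?thesis by (simp add: cdf_bY e)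
qed

lemma cdf_bY_low: "0 \<le> x \<Longrightarrow> x < m \<Longrightarrow> cdf bY (x - c) = 0 \<and> 0 < c \<and> m = c \<and> n = 0"
proof -
  assume x: "0 \<le> x" "x < m"
  then have c: "0 < c" "m = c" "n = 0" by (auto simp: m_def n_def max_def split: if_splits)
  have "(x - c - n) / (2 * d) \<le> 0" using x c d by (simp add: divide_nonpos_pos)
  then have "cdf bY (x - c) = 0" unfolding cdf_bY using x c by simp
  then show ?thesis using c by simp
qed

lemma tail_bX_mid: "n < y \<or> (y = n \<and> 0 < c) \<Longrightarrow> y \<le> n + 2 * d \<Longrightarrow> measure bX {c + y..} = LY y"
proof -
  assume y: "n < y \<or> (y = n \<and> 0 < c)" "y \<le> n + 2 * d"
  have e: "m + 2 * d - (c + y) = n + 2 * d - y" using mn by simp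
  have "0 \<le> (n + 2 * d - y) / (2 * d)" "(n + 2 * d - y) / (2 * d) \<le> 1" using y d by auto
  moreover have "0 < c + y" using y mn by auto
  ultimately show ?thesis by (simp add: tail_bX e LY_def)
qed

lemma tail_bX_high: "n + 2 * d \<le> y \<Longrightarrow> measure bX {c + y..} = 0"
proof -
  assume y: "n + 2 * d \<le> y"
  have e: "m + 2 * d - (c + y) = n + 2 * d - y" using mn by simp
  have "(n + 2 * d - y) / (2 * d) \<le> 0" using y d by (simp add: divide_nonpos_pos)
  moreover have "0 < c + y" using y mn d by auto
  ultimately show ?thesis by (simp add: tail_bX e)
qed

lemma tail_bX_low: "c + y \<le> 0 \<Longrightarrow> measure bX {c + y..} = 1"
proof -
  assume y: "c + y \<le> 0"
  have "1 \<le> (m + 2 * d - (c + y)) / (2 * d)" using y d mn by auto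
  then show ?thesis using y by (simp add: tail_bX)
qed

lemma tail_bX_zero: "measure bX {c..} = LY 0"
proof -
  consider "c > 0" | "c = 0" | "c < 0" by linarith
  then show ?thesis
  proof cases
    case 1 then show ?thesis using tail_bX_mid[of 0] d by (simp add: n_def)
  next
    case 2 then show ?thesis using tail_bX_low[of 0] czero LY_bot by (simp add: n_def)
  next
    case 3 then show ?thesis using tail_bX_low[of 0] cneg by simp
  qed
qed

lemma cdf_bY_le: "0 \<le> x \<Longrightarrow> cdf bY (x - c) \<le> LX x"
  and cdf_bY_less: "0 \<le> x \<Longrightarrow> cdf bY (x - c) = LX x \<Longrightarrow> x = 0 \<or> (m \<le> x \<and> x \<le> m + 2 * d)"
proof -
  have *: "cdf bY (x - c) \<le> LX x \<and> (cdf bY (x - c) = LX x \<longrightarrow> x = 0 \<or> (m \<le> x \<and> x \<le> m + 2 * d))"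
    if x: "0 \<le> x" for x
  proof -
    consider "x < m" | "m \<le> x" "x \<le> m + 2 * d" | "m + 2 * d < x" by linarith
    then show ?thesis
    proof cases
      case 1
      then show ?thesis using cdf_bY_low[OF x 1] cpos LX_mono[of 0 x] x by (cases "x = 0") auto
    next
      case 2
      then show ?thesis using cdf_bY_mid by simp
    next
      case 3
      then show ?thesis using cdf_bY_high[of x] LX_mono[OF 3] LX_top by simp
    qed
  qed
  show "0 \<le> x \<Longrightarrow> cdf bY (x - c) \<le> LX x" using * by blast
  show "0 \<le> x \<Longrightarrow> cdf bY (x - c) = LX x \<Longrightarrow> x = 0 \<or> (m \<le> x \<and> x \<le> m + 2 * d)" using * by blast
qed

lemma tail_bX_ge: "0 \<le> y \<Longrightarrow> LY y \<le> measure bX {c + y..}"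
  and tail_bX_greater: "0 \<le> y \<Longrightarrow> measure bX {c + y..} = LY y \<Longrightarrow>
    y \<le> n + 2 * d \<and> (y = 0 \<or> n < y)"
proof -
  have *: "LY y \<le> measure bX {c + y..} \<and> (measure bX {c + y..} = LY y \<longrightarrow>
    y \<le> n + 2 * d \<and> (y = 0 \<or> n < y))"
    if y: "0 \<le> y" for y
  proof -
    consider "y = 0" | "0 < y" "y \<le> n" | "n < y" "y \<le> n + 2 * d" | "n + 2 * d < y" using y by linarith
    then show ?thesis
    proof cases
      case 1
      then show ?thesis using tail_bX_zero mn d by auto
    next
      case 2
      then have c: "c < 0" "n = - c" by (auto simp: n_def max_def split: if_splits)
      then show ?thesis using tail_bX_low[of y] 2 LY_mono[OF 2(1)] cneg by auto
    next
      case 3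
      then show ?thesis using tail_bX_mid by simp
    next
      case 4
      then show ?thesis using tail_bX_high[of y] LY_mono[OF 4] LY_top by simp
    qed
  qed
  show "0 \<le> y \<Longrightarrow> LY y \<le> measure bX {c + y..}" using * by blast
  show "0 \<le> y \<Longrightarrow> measure bX {c + y..} = LY y \<Longrightarrow> y \<le> n + 2 * d \<and> (y = 0 \<or> n < y)"
    using * by blast
qed

lemma rbX: "real_distribution bX" and rbY: "real_distribution bY"
  using bX_strategy bY_strategy by (auto dest: strategiesD(1))

lemma int_cdf: "real_distribution X \<Longrightarrow> real_distribution Y \<Longrightarrow> integrable X (\<lambda>x. cdf Y (x - c))"
proof -
  assume X: "real_distribution X" and Y: "real_distribution Y"
  interpret X: real_distribution X by fact
  interpret Y: real_distribution Y by fact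
  show ?thesis
    by (rule X.integrable_const_bound[where B=1])
      (auto simp: Y.cdf_nonneg Y.cdf_bounded_prob cdf_measurable[OF Y])
qed

lemma int_tail: "real_distribution X \<Longrightarrow> real_distribution Y \<Longrightarrow> integrable Y (\<lambda>y. measure X {c + y..})"
proof -
  assume X: "real_distribution X" and Y: "real_distribution Y"
  interpret X: real_distribution X by fact
  interpret Y: real_distribution Y by fact
  show ?thesis
    by (rule Y.integrable_const_bound[where B=1]) (auto simp: tail_measurable[OF X])
qed

lemma int_affine:
  assumes "X \<in> strategies k"
  shows "integrable X (\<lambda>x. u + v * x)" "(\<integral>x. u + v * x \<partial>X) = u + v * k"
proof -
  interpret X: real_distribution X using strategiesD(1)[OF assms] .
  show "integrable X (\<lambda>x. u + v * x)" "(\<integral>x. u + v * x \<partial>X) = u + v * k"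
    using strategiesD(3,4)[OF assms] X.prob_space by auto
qed

lemma LX_affine: "LX = (\<lambda>x. (1 - q - q * m / (2 * d)) + q / (2 * d) * x)"
  by (auto simp: LX_def diff_divide_distrib algebra_simps)

lemma LY_affine: "LY = (\<lambda>y. p * (n + 2 * d) / (2 * d) + - (p / (2 * d)) * y)"
  by (auto simp: LY_def diff_divide_distrib algebra_simps)

lemma int_LX: "X \<in> strategies k \<Longrightarrow> integrable X LX" "X \<in> strategies k \<Longrightarrow> (\<integral>x. LX x \<partial>X) = LX k"
  unfolding LX_affine using int_affine by blast+

lemma int_LY: "X \<in> strategies k \<Longrightarrow> integrable X LY" "X \<in> strategies k \<Longrightarrow> (\<integral>x. LY x \<partial>X) = LY k"
  unfolding LY_affine using int_affine by blast+

lemma LX_meas [measurable]: "LX \<in> borel_measurable borel" by (simp add: LX_def)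
lemma LY_meas [measurable]: "LY \<in> borel_measurable borel" by (simp add: LY_def)

lemma eq_set: "f \<in> borel_measurable borel \<Longrightarrow> g \<in> borel_measurable borel \<Longrightarrow>
  {x::real. f x = (g x :: real)} \<in> sets borel"
  using borel_measurable_eq[of f borel g] by (simp add: pred_def)

lemma AE_bX: "AE x in bX. cdf bY (x - c) = LX x"
  unfolding bX_def
proof (subst AE_mixture_return[OF rU(1) pq(1)])
  have "AE x in uniform_measure lborel {m..m + 2 * d}. cdf bY (x - c) = LX x"
    by (rule AE_uniform_measureI) (auto simp: cdf_bY_mid)
  moreover have "p = 1 \<or> cdf bY (0 - c) = LX 0"
  proof (cases "0 < c")
    case True
    then have "0 < m" by (simp add: m_def)
    from cdf_bY_low[OF order_refl this] cpos[OF True] show ?thesis by metis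
  next
    case False
    then have "m = 0" by (simp add: m_def)
    then show ?thesis using cdf_bY_mid[of 0] d by simp
  qed
  ultimately show "(p = 0 \<or> (AE x in uniform_measure lborel {m..m + 2 * d}. cdf bY (x - c) = LX x)) \<and>
    (p = 1 \<or> cdf bY (0 - c) = LX 0)" by blast
qed (use eq_set[OF cdf_measurable[OF rbY] LX_meas] in auto)

lemma AE_bY: "AE y in bY. measure bX {c + y..} = LY y"
  unfolding bY_def
proof (subst AE_mixture_return[OF rU(2) pq(2)])
  have "AE y in lborel. y \<noteq> n" by (rule AE_lborel_singleton)
  then have "AE y in uniform_measure lborel {n..n + 2 * d}. measure bX {c + y..} = LY y"
    by (intro AE_uniform_measureI) (auto elim!: eventually_mono intro!: tail_bX_mid)
  then show "(q = 0 \<or> (AE y in uniform_measure lborel {n..n + 2 * d}. measure bX {c + y..} = LY y)) \<and>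
    (q = 1 \<or> measure bX {c + 0..} = LY 0)" using tail_bX_zero by simp
qed (use eq_set[OF tail_measurable[OF rbX] LY_meas] in auto)

lemma value_LX: "payoff_A c bX bY = LX a"
proof -
  have "payoff_A c bX bY = (\<integral>x. LX x \<partial>bX)"
    unfolding payoff_cdf[OF rbX rbY]
    by (intro integral_cong_AE real_distribution.measurable_finite_borel[OF rbX]
        cdf_measurable[OF rbY] LX_meas AE_bX)
  then show ?thesis using int_LX(2)[OF bX_strategy] by simp
qed

lemma value_LY: "payoff_A c bX bY = LY b"
proof -
  have "payoff_A c bX bY = (\<integral>y. LY y \<partial>bY)"
    unfolding payoff_tail[OF rbX rbY]
    by (intro integral_cong_AE real_distribution.measurable_finite_borel[OF rbY]
        tail_measurable[OF rbX] LY_meas AE_bY)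
  then show ?thesis using int_LY(2)[OF bY_strategy] by simp
qed

lemma best_X:
  assumes X: "X \<in> strategies a"
  shows "payoff_A c X bY \<le> LX a"
    and "payoff_A c X bY = LX a \<Longrightarrow> AE x in X. cdf bY (x - c) = LX x"
proof -
  note rX = strategiesD(1)[OF X]
  have ae: "AE x in X. cdf bY (x - c) \<le> LX x"
    using strategiesD(2)[OF X] by eventually_elim (rule cdf_bY_le)
  show "payoff_A c X bY \<le> LX a"
    unfolding payoff_cdf[OF rX rbY] int_LX(2)[OF X, symmetric]
    by (rule integral_mono_AE[OF int_cdf[OF rX rbY] int_LX(1)[OF X] ae])
  assume "payoff_A c X bY = LX a"
  then show "AE x in X. cdf bY (x - c) = LX x"
    unfolding payoff_cdf[OF rX rbY] int_LX(2)[OF X, symmetric]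
    by (intro AE_eq_of_le_integral_eq int_cdf[OF rX rbY] int_LX(1)[OF X] ae)
qed

lemma best_Y:
  assumes Y: "Y \<in> strategies b"
  shows "LY b \<le> payoff_A c bX Y"
    and "payoff_A c bX Y = LY b \<Longrightarrow> AE y in Y. measure bX {c + y..} = LY y"
proof -
  note rY = strategiesD(1)[OF Y]
  have ae: "AE y in Y. LY y \<le> measure bX {c + y..}"
    using strategiesD(2)[OF Y] by eventually_elim (rule tail_bX_ge)
  show "LY b \<le> payoff_A c bX Y"
    unfolding payoff_tail[OF rbX rY] int_LY(2)[OF Y, symmetric]
    by (rule integral_mono_AE[OF int_LY(1)[OF Y] int_tail[OF rbX rY] ae])
  assume *: "payoff_A c bX Y = LY b"
  have "AE y in Y. LY y = measure bX {c + y..}"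
    by (rule AE_eq_of_le_integral_eq[OF int_LY(1)[OF Y] int_tail[OF rbX rY] ae])
      (use * in \<open>simp add: payoff_tail[OF rbX rY] int_LY(2)[OF Y]\<close>)
  then show "AE y in Y. measure bX {c + y..} = LY y" by eventually_elim simp
qed

lemma NE_bar: "followers_NE a b c bX bY"
  unfolding followers_NE_def payoff_B_def
  using bX_strategy bY_strategy best_X(1) best_Y(1) value_LX value_LY by auto

lemma unique_X:
  assumes X: "X \<in> strategies a" and opt: "\<And>Y. Y \<in> strategies b \<Longrightarrow> LX a \<le> payoff_A c X Y"
  shows "X = bX"
proof -
  define T where "T = n + 2 * d"
  define G where "G y = measure X {c + y..}" for y
  define V where "V = LX a"
  note rX = strategiesD(1)[OF X]
  interpret X: real_distribution X by fact
  interpret bX: real_distribution bX by (rule rbX)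
  have V: "V = LY b" using value_LX value_LY by (simp add: V_def)
  have eqV: "payoff_A c X bY = V"
    using opt[OF bY_strategy] best_X(1)[OF X] by (simp add: V_def)
  have supp: "AE x in X. x = 0 \<or> (m \<le> x \<and> x \<le> m + 2 * d)"
    using best_X(2)[OF X eqV[unfolded V_def]] strategiesD(2)[OF X]
    by eventually_elim (rule cdf_bY_less)
  obtain \<mu> where mu: "\<And>y. 0 \<le> y \<Longrightarrow> V - \<mu> * (y - b) \<le> G y"
    using affine_bound_X[OF rX b opt] unfolding G_def V_def by blast
  define L where "L = (\<lambda>y. V - \<mu> * (y - b))"
  have L_aff: "L = (\<lambda>y. (V + \<mu> * b) + (- \<mu>) * y)" by (auto simp: L_def algebra_simps)
  have iL: "integrable bY L" "(\<integral>y. L y \<partial>bY) = V"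
    using int_affine[OF bY_strategy, of "V + \<mu> * b" "- \<mu>"] unfolding L_aff by auto
  have "AE y in bY. L y \<le> G y"
    using strategiesD(2)[OF bY_strategy] by eventually_elim (use mu in \<open>auto simp: L_def\<close>)
  moreover have "integrable bY G" unfolding G_def by (rule int_tail[OF rX rbY])
  moreover have "(\<integral>y. G y \<partial>bY) = V" using eqV unfolding payoff_tail[OF rX rbY] G_def .
  ultimately have "AE y in bY. L y = G y"
    using iL by (intro AE_eq_of_le_integral_eq) auto
  then have "(q = 0 \<or> (AE y in uniform_measure lborel {n..n + 2 * d}. L y = G y)) \<and> (q = 1 \<or> L 0 = G 0)"
    unfolding bY_def
    by (subst (asm) AE_mixture_return[OF rU(2) pq(2)])
      (use eq_set[OF _ tail_measurable[OF rX], of L] in \<open>auto simp: L_def G_def\<close>)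
  then have ae: "AE y in uniform_measure lborel {n..T}. L y = G y" and G0: "q = 1 \<or> L 0 = G 0"
    using q0 unfolding T_def by auto
  have LG: "{y. L y = G y} \<in> sets borel"
    unfolding G_def by (rule eq_set[OF _ tail_measurable[OF rX]]) (simp add: L_def)
  have dense: "\<exists>z. u < z \<and> z < v \<and> L z = G z" if "n \<le> u" "u < v" "v \<le> T" for u v
    by (rule AE_interval_dense[OF ae LG]) (use d that in \<open>auto simp: T_def\<close>)
  have Ghigh: "G y = 0" if "T < y" for y
  proof -
    have "AE x in X. x \<notin> {c + y..}"
      using supp by eventually_elim (use that mn d in \<open>auto simp: T_def\<close>)
    then show ?thesis unfolding G_def by (simp add: X.prob_eq_0)
  qed
  have Gmono: "G y \<le> G x" if "x \<le> y" for x y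
    unfolding G_def using that by (intro X.finite_measure_mono) auto
  have "isCont L T" unfolding L_def by (intro continuous_intros)
  have LT: "L T = 0"
  proof (rule antisym)
    show "L T \<le> 0"
    proof (rule ccontr)
      assume *: "\<not> L T \<le> 0"
      have "\<forall>\<^sub>F y in at T. 0 < L y"
        using \<open>isCont L T\<close> * by (intro order_tendstoD(1)[of L "L T"]) (auto simp: isCont_def)
      then obtain e where e: "e > 0" "\<And>y. y \<noteq> T \<Longrightarrow> dist y T < e \<Longrightarrow> 0 < L y"
        unfolding eventually_at by auto
      have "0 < L (T + e / 2)" using e by (auto simp: dist_real_def)
      moreover have "L (T + e / 2) \<le> G (T + e / 2)"
        using mu[of "T + e / 2"] e d mn by (auto simp: L_def T_def)
      ultimately show False using Ghigh[of "T + e / 2"] e by simp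
    qed
    show "0 \<le> L T"
    proof (rule ccontr)
      assume *: "\<not> 0 \<le> L T"
      have "\<forall>\<^sub>F y in at T. L y < 0"
        using \<open>isCont L T\<close> * by (intro order_tendstoD(2)[of L "L T"]) (auto simp: isCont_def)
      then obtain e where e: "e > 0" "\<And>y. y \<noteq> T \<Longrightarrow> dist y T < e \<Longrightarrow> L y < 0"
        unfolding eventually_at by auto
      obtain z where z: "max n (T - e) < z" "z < T" "L z = G z"
        using dense[of "max n (T - e)" T] e d by (auto simp: T_def)
      have "L z < 0" using e(2)[of z] z(1,2) by (auto simp: dist_real_def)
      moreover have "0 \<le> G z" by (simp add: G_def)
      ultimately show False using z(3) by linarith
    qed
  qed
  have Tb: "b < T" using q1 b d mn by (simp add: q_def T_def field_simps)
  have "L = LY"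
  proof
    fix y
    have "\<mu> * (T - b) = V" using LT by (simp add: L_def)
    then have "\<mu> * (T - b) = p / (2 * d) * (T - b)"
      unfolding V by (simp add: LY_def T_def)
    moreover have "T - b \<noteq> 0" using Tb by simp
    ultimately have "\<mu> = p / (2 * d)" using mult_right_cancel by blast
    then show "L y = LY y" unfolding L_def V
      by (simp add: LY_affine algebra_simps diff_divide_distrib)
  qed
  have Gmid: "G y = LY y" if y: "n < y" "y \<le> T" for y
  proof (rule antisym)
    show "LY y \<le> G y" using mu[of y] y mn \<open>L = LY\<close> by (auto simp: L_def fun_eq_iff)
    show "G y \<le> LY y"
    proof (rule ccontr)
      assume *: "\<not> G y \<le> LY y"
      define e where "e = (G y - LY y) / (p / (2 * d))"
      have e: "e > 0" using * p0 d by (auto simp: e_def)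
      obtain z where z: "max n (y - e) < z" "z < y" "L z = G z"
        using dense[of "max n (y - e)" y] y e by auto
      have "LY z < LY (y - e)" using z by (intro LY_mono) auto
      also have "LY (y - e) = LY y + p / (2 * d) * e"
        by (simp add: LY_affine algebra_simps diff_divide_distrib)
      also have "\<dots> = G y" using p0 d by (simp add: e_def)
      also have "\<dots> \<le> G z" using z by (intro Gmono) auto
      finally show False using z \<open>L = LY\<close> by simp
    qed
  qed
  have tails: "measure X {t..} = measure bX {t..}" for t
  proof -
    consider "t \<le> 0" | "0 < t" "t \<le> m" | "m < t" "t \<le> m + 2 * d" | "m < t" "m + 2 * d < t" by linarith
    then show ?thesis
    proof cases
      case 1
      have "AE x in X. x \<in> {t..}" using strategiesD(2)[OF X] by eventually_elim (use 1 in auto)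
      then have "measure X {t..} = 1" by (simp add: X.prob_eq_1)
      moreover have "AE x in bX. x \<in> {t..}" using strategiesD(2)[OF bX_strategy] by eventually_elim (use 1 in auto)
      then have "measure bX {t..} = 1" by (simp add: bX.prob_eq_1)
      ultimately show ?thesis by simp
    next
      case 2
      then have c: "0 < c" "m = c" "n = 0" by (auto simp: m_def n_def max_def split: if_splits)
      have "AE x in X. x \<in> {t..} \<longleftrightarrow> x \<in> {c..}"
        using supp by eventually_elim (use 2 c in auto)
      then have "measure X {t..} = measure X {c..}"
        by (rule X.finite_measure_eq_AE) auto
      also have "\<dots> = LY 0" using G0 cpos[OF c(1)] \<open>L = LY\<close> by (auto simp: G_def)
      also have "\<dots> = measure bX {t..}"
      proof -
        have "1 \<le> (m + 2 * d - t) / (2 * d)" using 2 d by simp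
        then show ?thesis unfolding tail_bX using 2 LY_bot c by simp
      qed
      finally show ?thesis .
    next
      case 3
      then have "measure X {t..} = LY (t - c)" using Gmid[of "t - c"] mn by (auto simp: G_def T_def)
      then show ?thesis using tail_bX_mid[of "t - c"] 3 mn by auto
    next
      case 4
      then have "measure X {t..} = 0" using Ghigh[of "t - c"] mn by (auto simp: G_def T_def)
      then show ?thesis using tail_bX_high[of "t - c"] 4 mn by auto
    qed
  qed
  show ?thesis
  proof (rule measure_eqI_lessThan)
    fix t :: real
    have U: "(\<Union>k. {t + 1 / real (Suc k)..}) = {t<..}"
    proof (intro equalityI subsetI)
      fix x assume "x \<in> {t<..}"
      then obtain k where "1 / real (Suc k) < x - t"
        using reals_Archimedean[of "x - t"] by (auto simp: inverse_eq_divide)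
      then have "x \<in> {t + 1 / real (Suc k)..}" by simp
      then show "x \<in> (\<Union>k. {t + 1 / real (Suc k)..})" by blast
    next
      fix x assume "x \<in> (\<Union>k. {t + 1 / real (Suc k)..})"
      then obtain k where "t + 1 / real (Suc k) \<le> x" by auto
      moreover have "0 < 1 / real (Suc k)" by simp
      ultimately show "x \<in> {t<..}" unfolding greaterThan_iff by linarith
    qed
    have inc: "incseq (\<lambda>k. {t + 1 / real (Suc k)..})"
    proof (rule incseq_SucI)
      fix k
      have "1 / real (Suc (Suc k)) \<le> 1 / real (Suc k)" by (rule frac_le) auto
      then show "{t + 1 / real (Suc k)..} \<le> {t + 1 / real (Suc (Suc k))..}"
        unfolding atLeast_subset_iff by linarith
    qed
    have "(\<lambda>k. measure X {t + 1 / real (Suc k)..}) \<longlonglongrightarrow> measure X {t<..}"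
      unfolding U[symmetric] by (rule X.finite_Lim_measure_incseq[OF _ inc]) auto
    moreover have "(\<lambda>k. measure bX {t + 1 / real (Suc k)..}) \<longlonglongrightarrow> measure bX {t<..}"
      unfolding U[symmetric] by (rule bX.finite_Lim_measure_incseq[OF _ inc]) auto
    ultimately have "measure X {t<..} = measure bX {t<..}"
      unfolding tails by (rule LIMSEQ_unique)
    then show "emeasure X {t<..} = emeasure bX {t<..}"
      by (simp add: X.emeasure_eq_measure bX.emeasure_eq_measure)
    show "emeasure X {t<..} < \<infinity>" by (simp add: X.emeasure_eq_measure)
  qed auto
qed

lemma unique_Y:
  assumes Y: "Y \<in> strategies b" and opt: "\<And>X. X \<in> strategies a \<Longrightarrow> payoff_A c X Y \<le> LX a"
  shows "Y = bY"
proof -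
  define T where "T = m + 2 * d"
  define F where "F x = cdf Y (x - c)" for x
  define V where "V = LX a"
  note rY = strategiesD(1)[OF Y]
  interpret Y: real_distribution Y by fact
  interpret bY: real_distribution bY by (rule rbY)
  have V: "V = LY b" using value_LX value_LY by (simp add: V_def)
  have eqV: "payoff_A c bX Y = V"
    using opt[OF bX_strategy] best_Y(1)[OF Y] V by (simp add: V_def)
  have supp: "AE y in Y. y \<le> n + 2 * d \<and> (y = 0 \<or> n < y)"
    using best_Y(2)[OF Y eqV[unfolded V]] strategiesD(2)[OF Y]
    by eventually_elim (rule tail_bX_greater)
  obtain \<mu> where mu: "\<And>x. 0 \<le> x \<Longrightarrow> F x \<le> V + \<mu> * (x - a)"
    using affine_bound_Y[OF rY a opt] unfolding F_def V_def by blast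
  define L where "L = (\<lambda>x. V + \<mu> * (x - a))"
  have L_aff: "L = (\<lambda>x. (V - \<mu> * a) + \<mu> * x)" by (auto simp: L_def algebra_simps)
  have iL: "integrable bX L" "(\<integral>x. L x \<partial>bX) = V"
    using int_affine[OF bX_strategy, of "V - \<mu> * a" "\<mu>"] unfolding L_aff by auto
  have "AE x in bX. F x \<le> L x"
    using strategiesD(2)[OF bX_strategy] by eventually_elim (use mu in \<open>auto simp: L_def\<close>)
  moreover have "integrable bX F" unfolding F_def by (rule int_cdf[OF rbX rY])
  moreover have "(\<integral>x. F x \<partial>bX) = V" using eqV unfolding payoff_cdf[OF rbX rY] F_def .
  ultimately have "AE x in bX. F x = L x"
    using iL by (intro AE_eq_of_le_integral_eq) auto
  then have "(p = 0 \<or> (AE x in uniform_measure lborel {m..m + 2 * d}. F x = L x)) \<and> (p = 1 \<or> F 0 = L 0)"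
    unfolding bX_def
    by (subst (asm) AE_mixture_return[OF rU(1) pq(1)])
      (use eq_set[OF cdf_measurable[OF rY], of L] in \<open>auto simp: L_def F_def\<close>)
  then have ae: "AE x in uniform_measure lborel {m..T}. F x = L x" and F0: "p = 1 \<or> F 0 = L 0"
    using p0 unfolding T_def by auto
  have FL: "{x. F x = L x} \<in> sets borel"
    unfolding F_def by (rule eq_set[OF cdf_measurable[OF rY]]) (simp add: L_def)
  have dense: "\<exists>z. u < z \<and> z < v \<and> F z = L z" if "m \<le> u" "u < v" "v \<le> T" for u v
    by (rule AE_interval_dense[OF ae FL]) (use d that in \<open>auto simp: T_def\<close>)
  have Fhigh: "F x = 1" if "T \<le> x" for x
  proof -
    have "AE y in Y. y \<in> {..x - c}"
      using supp by eventually_elim (use that mn d in \<open>auto simp: T_def\<close>)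
    then show ?thesis unfolding F_def cdf_def by (simp add: Y.prob_eq_1)
  qed
  have Fmono: "F x \<le> F y" if "x \<le> y" for x y
    unfolding F_def using that by (intro Y.cdf_nondecreasing) auto
  have "isCont L T" unfolding L_def by (intro continuous_intros)
  have LT: "L T = 1"
  proof (rule antisym)
    show "1 \<le> L T" using mu[of T] Fhigh[of T] d mn by (auto simp: L_def T_def)
    show "L T \<le> 1"
    proof (rule ccontr)
      assume *: "\<not> L T \<le> 1"
      have "\<forall>\<^sub>F y in at T. 1 < L y"
        using \<open>isCont L T\<close> * by (intro order_tendstoD(1)[of L "L T"]) (auto simp: isCont_def)
      then obtain e where e: "e > 0" "\<And>y. y \<noteq> T \<Longrightarrow> dist y T < e \<Longrightarrow> 1 < L y"
        unfolding eventually_at by auto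
      obtain z where z: "max m (T - e) < z" "z < T" "F z = L z"
        using dense[of "max m (T - e)" T] e d by (auto simp: T_def)
      have "1 < L z" using e z by (auto simp: dist_real_def)
      moreover have "F z \<le> 1" unfolding F_def by (rule Y.cdf_bounded_prob)
      ultimately show False using z by simp
    qed
  qed
  have Ta: "a < T" using p1 a d mn by (simp add: p_def T_def field_simps)
  have "L = LX"
  proof
    fix x
    have "\<mu> * (T - a) = 1 - V" using LT by (simp add: L_def)
    also have "\<dots> = LX T - LX a" using LX_top by (simp add: V_def T_def)
    also have "\<dots> = q / (2 * d) * (T - a)"
      by (simp add: LX_affine algebra_simps diff_divide_distrib)
    finally have "\<mu> * (T - a) = q / (2 * d) * (T - a)" .
    moreover have "T - a \<noteq> 0" using Ta by simp
    ultimately have "\<mu> = q / (2 * d)" using mult_right_cancel by blast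
    then show "L x = LX x" unfolding L_def V_def
      by (simp add: LX_affine algebra_simps diff_divide_distrib)
  qed
  have Fmid: "F x = LX x" if x: "m < x" "x \<le> T" for x
  proof (rule antisym)
    show "F x \<le> LX x" using mu[of x] x mn \<open>L = LX\<close> by (auto simp: L_def fun_eq_iff)
    show "LX x \<le> F x"
    proof (rule ccontr)
      assume *: "\<not> LX x \<le> F x"
      define e where "e = (LX x - F x) / (q / (2 * d))"
      have e: "e > 0" using * q0 d by (auto simp: e_def)
      obtain z where z: "max m (x - e) < z" "z < x" "F z = L z"
        using dense[of "max m (x - e)" x] x e by auto
      have "F x = LX x - q / (2 * d) * e" using q0 d by (simp add: e_def)
      also have "\<dots> = LX (x - e)"
        by (simp add: LX_affine algebra_simps diff_divide_distrib)
      also have "\<dots> < LX z" using z by (intro LX_mono) auto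
      also have "\<dots> = F z" using z \<open>L = LX\<close> by simp
      also have "\<dots> \<le> F x" using z by (intro Fmono) auto
      finally show False by simp
    qed
  qed
  have above: "cdf Y t = cdf bY t" if "n < t" for t
  proof (cases "t + c \<le> T")
    case True
    then show ?thesis using Fmid[of "t + c"] cdf_bY_mid[of "t + c"] that mn by (auto simp: F_def T_def)
  next
    case False
    then show ?thesis using Fhigh[of "t + c"] cdf_bY_high[of "t + c"] by (auto simp: F_def T_def)
  qed
  have "cdf Y t = cdf bY t" for t
  proof -
    consider "t < 0" | "n < t" | "t = 0" "n = 0" | "0 \<le> t" "t \<le> n" "0 < n" using mn by linarith
    then show ?thesis
    proof cases
      case 1
      have "AE x in Y. x \<notin> {..t}" using strategiesD(2)[OF Y] by eventually_elim (use 1 in auto)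
      then have "measure Y {..t} = 0" by (simp add: Y.prob_eq_0)
      moreover have "AE x in bY. x \<notin> {..t}" using strategiesD(2)[OF bY_strategy] by eventually_elim (use 1 in auto)
      then have "measure bY {..t} = 0" by (simp add: bY.prob_eq_0)
      ultimately show ?thesis by (simp add: cdf_def)
    next
      case 2
      then show ?thesis by (rule above)
    next
      case 3
      have limY: "(cdf Y \<longlongrightarrow> cdf Y 0) (at_right 0)"
        and limbY: "(cdf bY \<longlongrightarrow> cdf bY 0) (at_right 0)"
        using Y.cdf_is_right_cont[of 0] bY.cdf_is_right_cont[of 0] by (auto simp: continuous_within)
      have "\<forall>\<^sub>F t in at_right 0. cdf Y t = cdf bY t"
        using above 3 by (auto simp: eventually_at_filter)
      from tendsto_cong[OF this] limY have "(cdf bY \<longlongrightarrow> cdf Y 0) (at_right 0)" by blast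
      from tendsto_unique[OF trivial_limit_at_right_real this limbY] have "cdf Y 0 = cdf bY 0" .
      then show ?thesis using 3 by simp
    next
      case 4
      then have c: "c < 0" "m = 0" "n = - c" by (auto simp: m_def n_def max_def split: if_splits)
      have "AE y in Y. y \<in> {..t} \<longleftrightarrow> y \<in> {..n}"
        using supp strategiesD(2)[OF Y] by eventually_elim (use 4 c in auto)
      then have "cdf Y t = cdf Y n"
        unfolding cdf_def by (rule Y.finite_measure_eq_AE) auto
      also have "\<dots> = LX 0" using F0 cneg[OF c(1)] \<open>L = LX\<close> c by (auto simp: F_def)
      also have "\<dots> = cdf bY t"
      proof -
        have "(t - n) / (2 * d) \<le> 0" using 4 d by (simp add: divide_nonpos_pos)
        then show ?thesis unfolding cdf_bY using 4 LX_bot c by simp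
      qed
      finally show ?thesis .
    qed
  qed
  then show ?thesis by (intro cdf_unique[OF rY rbY]) auto
qed

lemma NE_iff: "followers_NE a b c X Y \<longleftrightarrow> X = bX \<and> Y = bY"
proof
  assume ne: "followers_NE a b c X Y"
  then have X: "X \<in> strategies a" and Y: "Y \<in> strategies b"
    and oX: "\<And>G. G \<in> strategies a \<Longrightarrow> payoff_A c G Y \<le> payoff_A c X Y"
    and oY: "\<And>G. G \<in> strategies b \<Longrightarrow> payoff_A c X Y \<le> payoff_A c X G"
    by (auto simp: followers_NE_def payoff_B_def)
  have "payoff_A c X Y = LX a"
    using best_X(1)[OF X] best_Y(1)[OF Y] oX[OF bX_strategy] oY[OF bY_strategy]
      value_LX value_LY by linarith
  then show "X = bX \<and> Y = bY"
    using unique_X[OF X] unique_Y[OF Y] oX oY by simp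
qed (use NE_bar in simp)

end

lemma NE_saddle:
  fixes a b c :: real
  assumes "0 < b" "b \<le> a"
  defines "d \<equiv> NE_d a b c" and "m \<equiv> max 0 c" and "n \<equiv> max 0 (- c)"
  shows "lotto_saddle a b c d m n (a / (m + d)) (b / (n + d))
    (\<lambda>x. 1 - b / (n + d) + b / (n + d) * (x - m) / (2 * d))
    (\<lambda>y. a / (m + d) * (n + 2 * d - y) / (2 * d))"
proof -
  have a: "0 < a" using assms by simp
  define s0 where "s0 = (b + sqrt (b\<^sup>2 + 8 * a * b)) / 4"
  have r0: "NE_r0 a b = a - s0" by (simp add: NE_r0_def s0_def)
  have sq: "(sqrt (b\<^sup>2 + 8 * a * b))\<^sup>2 = b\<^sup>2 + 8 * a * b" using assms(1) a by simp
  have s0q: "2 * s0 * s0 - b * s0 - a * b = 0"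
    using sq unfolding s0_def by (simp add: power2_eq_square field_simps)
  have ab: "b * b \<le> a * b" using assms(1,2) by (simp add: mult_right_mono)
  have "3 * b \<le> sqrt (b\<^sup>2 + 8 * a * b)"
    using ab by (intro real_le_rsqrt) (simp add: power2_eq_square)
  then have s0b: "b \<le> s0" by (simp add: s0_def)
  have s0a: "s0 \<le> a"
  proof (rule ccontr)
    assume "\<not> s0 \<le> a"
    then have "a < s0" by simp
    moreover have "0 < 2 * (s0 + a) - b" using calculation assms by simp
    ultimately have "0 < (s0 - a) * (2 * (s0 + a) - b)" by simp
    also have "\<dots> = (2 * s0 * s0 - b * s0) - (2 * a * a - b * a)" by (simp add: algebra_simps)
    also have "\<dots> = 2 * a * b - 2 * a * a" using s0q by (simp add: algebra_simps)
    also have "\<dots> \<le> 0" using assms(2) a by (simp add: mult_left_mono)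
    finally show False by simp
  qed
  consider (hi) "c \<ge> NE_r0 a b" | (mid) "0 \<le> c" "c < NE_r0 a b" | (neg) "c < 0" "c < NE_r0 a b"
    by linarith
  then show ?thesis
  proof cases
    case hi
    then have c: "0 \<le> c" "a - c \<le> s0" using s0a r0 by auto
    have d: "d = (b + sqrt (b\<^sup>2 + 2 * c * b)) / 2" using hi by (simp add: d_def NE_d_def)
    have "(sqrt (b\<^sup>2 + 2 * c * b))\<^sup>2 = b\<^sup>2 + 2 * c * b" using c assms(1) by simp
    then have dq: "2 * d * d - 2 * b * d - b * c = 0"
      unfolding d by (simp add: power2_eq_square field_simps)
    have "sqrt (b\<^sup>2) \<le> sqrt (b\<^sup>2 + 2 * c * b)" using c assms(1) by (intro real_sqrt_le_mono) simp
    then have db: "b \<le> d" using assms(1) by (simp add: d)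
    then have d0: "0 < d" using assms(1) by simp
    have db': "c > 0 \<Longrightarrow> b < d"
    proof (rule ccontr)
      assume "c > 0" "\<not> b < d"
      then have "d = b" using db by simp
      then show False using dq \<open>c > 0\<close> assms(1) by simp
    qed
    have ad: "a \<le> c + d"
    proof (rule ccontr)
      assume "\<not> a \<le> c + d"
      then have ds: "d < a - c" by simp
      define s where "s = a - c"
      have s: "d < s" "b < s" "s \<le> s0" "c = a - s" using ds db c by (auto simp: s_def)
      have "0 < (s - d) * (2 * (s + d) - 2 * b)" using s d0 by (intro mult_pos_pos) auto
      also have "\<dots> = (2 * s * s - 2 * b * s) - (2 * d * d - 2 * b * d)" by (simp add: algebra_simps)
      also have "\<dots> = 2 * s * s - b * s - a * b" using dq s(4) by (simp add: algebra_simps)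
      also have "\<dots> = (2 * s * s - b * s) - (2 * s0 * s0 - b * s0)" using s0q by simp
      also have "\<dots> = (s - s0) * (2 * (s + s0) - b)" by (simp add: algebra_simps)
      also have "\<dots> \<le> 0" using s s0b assms(1) by (intro mult_nonpos_nonneg) auto
      finally show False by simp
    qed
    have mn: "m = c" "n = 0" using c by (auto simp: m_def n_def)
    have "1 - b / d + b / d * (0 - c) / (2 * d) = (2 * d * d - 2 * b * d - b * c) / (2 * d * d)"
      using d0 by (simp add: field_simps)
    then have L0: "1 - b / d + b / d * (0 - c) / (2 * d) = 0" using dq by simp
    show ?thesis
    proof unfold_locales
      assume "c = 0"
      then have "a \<le> d" "d = b" using ad dq d0 by auto
      then show "a / (m + d) = 1" using assms a \<open>c = 0\<close> mn by auto
    qed (use a assms(1) d0 ad db db' L0 mn c in \<open>auto simp: m_def n_def\<close>)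
  next
    case mid
    have d: "d = a - c" using mid by (simp add: d_def NE_d_def)
    have ds: "s0 < d" using mid r0 d by simp
    then have d0: "0 < d" "b < d" using s0b assms(1) by auto
    have mn: "m = c" "n = 0" using mid by (auto simp: m_def n_def)
    have "0 \<le> (d - s0) * (2 * (d + s0) - b)" using ds s0b assms(1) by simp
    also have "\<dots> = 2 * d * d - b * d - a * b" using s0q by (simp add: algebra_simps)
    finally have "0 \<le> 2 * d * d - b * d - a * b" .
    moreover have "a = d + c" using d by simp
    ultimately have q: "0 \<le> 2 * d * d - 2 * b * d - b * c" by (simp add: algebra_simps)
    have "1 - b / d + b / d * (0 - c) / (2 * d) = (2 * d * d - 2 * b * d - b * c) / (2 * d * d)"
      using d0 by (simp add: field_simps)
    also have "\<dots> \<ge> 0" using q by simp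
    finally have L0: "0 \<le> 1 - b / d + b / d * (0 - c) / (2 * d)" .
    show ?thesis
      by unfold_locales (use a assms(1) d0 L0 mn mid d in \<open>auto simp: m_def n_def\<close>)
  next
    case neg
    have d: "d = (a + sqrt (a\<^sup>2 - 2 * c * a)) / 2" using neg by (simp add: d_def NE_d_def)
    have ca: "c * a < 0" using neg a by (simp add: mult_neg_pos)
    have "0 \<le> a\<^sup>2 - 2 * c * a" using ca zero_le_power2[of a] by linarith
    then have "(sqrt (a\<^sup>2 - 2 * c * a))\<^sup>2 = a\<^sup>2 - 2 * c * a" by simp
    then have dq: "2 * d * d - 2 * a * d + a * c = 0"
      unfolding d by (simp add: power2_eq_square field_simps)
    have "sqrt (a\<^sup>2) < sqrt (a\<^sup>2 - 2 * c * a)"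
      using ca by (intro real_sqrt_less_mono) linarith
    then have da: "a < d" using a by (simp add: d)
    then have d0: "0 < d" using a by simp
    have mn: "m = 0" "n = - c" using neg by (auto simp: m_def n_def)
    have L0: "a / d * (- c + 2 * d - 0) / (2 * d) = 1"
      using dq d0 by (simp add: field_simps)
    show ?thesis
      by unfold_locales (use a assms(1,2) d0 da L0 mn neg in \<open>auto simp: m_def n_def\<close>)
  qed
qed

lemma followers_NE_iff:
  assumes "0 < b" "b \<le> a"
  shows "followers_NE a b c X Y \<longleftrightarrow> X = NE_X a b c \<and> Y = NE_Y a b c"
proof -
  interpret lotto_saddle a b c "NE_d a b c" "max 0 c" "max 0 (- c)"
    "a / (max 0 c + NE_d a b c)" "b / (max 0 (- c) + NE_d a b c)"
    "\<lambda>x. 1 - b / (max 0 (- c) + NE_d a b c) +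
      b / (max 0 (- c) + NE_d a b c) * (x - max 0 c) / (2 * NE_d a b c)"
    "\<lambda>y. a / (max 0 c + NE_d a b c) * (max 0 (- c) + 2 * NE_d a b c - y) / (2 * NE_d a b c)"
    using NE_saddle[OF assms, of c] .
  have "bX = NE_X a b c" "bY = NE_Y a b c"
    by (auto simp: bX_def bY_def NE_X_def NE_Y_def Let_def)
  then show ?thesis using NE_iff by simp
qed

lemma NE_pair_eq:
  assumes "0 < b" "b \<le> a"
  shows "NE_pair a b c = (NE_X a b c, NE_Y a b c)"
  unfolding NE_pair_def by (rule the_equality) (auto simp: followers_NE_iff[OF assms])

end

(* The followers' game is zero-sum and raising c shrinks the winning event x >= c + y, so the
   equilibrium payoff P decreases in c; moreover P(0) = 1 - b/(2a). Up to the constant w_B the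
   regulator maximises (w_A - w_B) P(c) - H(|c|). Moving c in the direction that hurts the favoured
   player is strictly worse than c = 0, and so is any c whose cost H(|c|) exceeds the largest
   conceivable gain |w_A - w_B| |P(c) - P(0)|, where P(c) is only known to lie in [0, 1]. *)

theory Submission
  imports Defs
begin

section \<open>Monotonicity, range and value at zero of the equilibrium payoff\<close>

lemma payoff_A_antimono:
  assumes X: "real_distribution X" and Y: "real_distribution Y" and "c \<le> c'"
  shows "payoff_A c' X Y \<le> payoff_A c X Y"
proof -
  interpret X: real_distribution X by fact
  interpret Y: real_distribution Y by fact
  interpret XY: pair_prob_space X Y ..
  have "{(x, y). x \<ge> c + (y::real)} \<in> sets (X \<Otimes>\<^sub>M Y)" using winning_set[of c] by simp
  then show ?thesis
    unfolding payoff_A_def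
    by (rule XY.P.finite_measure_mono[rotated]) (use \<open>c \<le> c'\<close> in auto)
qed

lemma payoff_A_bounds:
  assumes X: "real_distribution X" and Y: "real_distribution Y"
  shows "0 \<le> payoff_A c X Y" "payoff_A c X Y \<le> 1"
proof -
  interpret X: real_distribution X by fact
  interpret Y: real_distribution Y by fact
  interpret XY: pair_prob_space X Y ..
  show "0 \<le> payoff_A c X Y" "payoff_A c X Y \<le> 1" by (simp_all add: payoff_A_def)
qed

text \<open>An exchange argument through the mixed profile (X', Y): B's optimality at c' allows
  replacing Y' by Y, lowering the threshold from c' to c enlarges the winning event, and A's
  optimality at c allows replacing X' by X. No closed form of the equilibria enters.\<close>

lemma followers_NE_payoff_antimono:
  assumes NE: "followers_NE a b c X Y" and NE': "followers_NE a b c' X' Y'" and "c \<le> c'"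
  shows "payoff_A c' X' Y' \<le> payoff_A c X Y"
proof -
  have "payoff_A c' X' Y' \<le> payoff_A c' X' Y"
    using NE NE' by (auto simp: followers_NE_def payoff_B_def)
  also have "\<dots> \<le> payoff_A c X' Y"
    using NE NE' \<open>c \<le> c'\<close>
    by (intro payoff_A_antimono) (auto simp: followers_NE_def dest: strategiesD(1))
  also have "\<dots> \<le> payoff_A c X Y"
    using NE NE' by (auto simp: followers_NE_def)
  finally show ?thesis .
qed

lemma NE_payoff_A_eq:
  assumes "0 < b" "b \<le> a"
  shows "NE_payoff_A a b c = payoff_A c (NE_X a b c) (NE_Y a b c)"
  by (simp add: NE_payoff_A_def NE_pair_eq[OF assms])

lemma NE_payoff_A_antimono:
  assumes "0 < b" "b \<le> a" "c \<le> c'"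
  shows "NE_payoff_A a b c' \<le> NE_payoff_A a b c"
  unfolding NE_payoff_A_eq[OF assms(1,2)]
  by (rule followers_NE_payoff_antimono[where a = a and b = b, OF _ _ assms(3)])
    (auto simp: followers_NE_iff[OF assms(1,2)])

lemma NE_strategies:
  assumes "0 < b" "b \<le> a"
  shows "NE_X a b c \<in> strategies a" "NE_Y a b c \<in> strategies b"
  using followers_NE_iff[OF assms, of c "NE_X a b c" "NE_Y a b c"] by (auto simp: followers_NE_def)

lemma NE_payoff_A_bounds:
  assumes "0 < b" "b \<le> a"
  shows "0 \<le> NE_payoff_A a b c" "NE_payoff_A a b c \<le> 1"
  unfolding NE_payoff_A_eq[OF assms]
  using NE_strategies[OF assms, THEN strategiesD(1)] by (auto intro: payoff_A_bounds)

lemma NE_payoff_A_0: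
  assumes "0 < b" "b \<le> a"
  shows "NE_payoff_A a b 0 = 1 - b / (2 * a)"
proof -
  define d where "d = NE_d a b 0"
  interpret lotto_saddle a b 0 d "max 0 0" "max 0 (- 0)" "a / (max 0 0 + d)" "b / (max 0 (- 0) + d)"
    "\<lambda>x. 1 - b / (max 0 (- 0) + d) + b / (max 0 (- 0) + d) * (x - max 0 0) / (2 * d)"
    "\<lambda>y. a / (max 0 0 + d) * (max 0 (- 0) + 2 * d - y) / (2 * d)"
    using NE_saddle[OF assms, of 0] unfolding d_def .
  \<comment> \<open>At c = 0 the locale fact \<open>czero\<close> says that A puts no atom at 0,
    that is, a / d = 1. This spares evaluating the branches of \<open>NE_d\<close>.\<close>
  have "d = a" using czero d by simp
  have "bX = NE_X a b 0" "bY = NE_Y a b 0"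
    using NE_bar followers_NE_iff[OF assms] by auto
  \<comment> \<open>The right-hand side is the affine majorant \<open>LX\<close> of B's equilibrium
    CDF, evaluated at A's mean a.\<close>
  then have "NE_payoff_A a b 0 = 1 - b / a + b / a * a / (2 * a)"
    using value_LX by (simp add: NE_payoff_A_eq[OF assms] \<open>d = a\<close>)
  also have "\<dots> = 1 - b / (2 * a)" using a by (simp add: divide_simps)
  finally show ?thesis .
qed

section \<open>Reduction to maximising a function of one real variable\<close>

text \<open>Since the followers' equilibrium is unique, only c remains to be chosen; and wA * P + wB
  * (1 - P) = wB + (wA - wB) * P, where the constant wB does not affect the comparison.\<close>

lemma NSE_intervention_iff:
  fixes a b wA wB :: real and H :: "real \<Rightarrow> real"
  assumes "0 < b" "b \<le> a" "wA + wB = 1"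
  defines "J \<equiv> \<lambda>c. (wA - wB) * NE_payoff_A a b c - H \<bar>c\<bar>"
  shows "NSE_intervention a b wA wB H UNIV cs \<longleftrightarrow> (\<forall>c. J c \<le> J cs)"
proof -
  have C: "payoff_C wA wB H c (NE_X a b c) (NE_Y a b c) = wB + J c" for c
    by (simp add: payoff_C_def payoff_B_def J_def NE_payoff_A_eq[OF assms(1,2)] algebra_simps)
  show ?thesis
    by (simp add: NSE_intervention_def is_NSE_def NE_pair_eq[OF assms(1,2)]
        NE_strategies[OF assms(1,2)] C)
qed

text \<open>Every point outside P loses strictly to z, so a global maximiser must lie in P, and a
  maximiser over P beats z and hence everything outside. Agreement of f and g is asked only on P, so
  that H \<bar>c\<bar> may become H (- c) or H c on a one-sided interval.\<close>

lemma global_max_iff_is_arg_max: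
  fixes f :: "'a \<Rightarrow> 'b :: linorder"
  assumes "P z" and "\<And>x. \<not> P x \<Longrightarrow> f x < f z" and eq: "\<And>x. P x \<Longrightarrow> f x = g x"
  shows "(\<forall>y. f y \<le> f x) \<longleftrightarrow> is_arg_max g P x"
proof
  assume "\<forall>y. f y \<le> f x"
  then show "is_arg_max g P x"
    using assms by (metis is_arg_max_linorder leD)
next
  assume x: "is_arg_max g P x"
  then have le: "f y \<le> f x" if "P y" for y
    using that eq by (metis is_arg_max_linorder)
  show "\<forall>y. f y \<le> f x"
    using le assms(1,2) by (meson less_imp_le order_trans)
qed

text \<open>Supplies the cutoffs c1 and c2: existence by the intermediate value theorem on an
  interval whose right end has H at least k, uniqueness by injectivity.\<close>

lemma strict_mono_on_ex1_level:
  fixes H :: "real \<Rightarrow> real"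
  assumes cont: "continuous_on {0..} H" and mono: "strict_mono_on {0..} H"
    and H0: "H 0 \<le> k" and lim: "filterlim H at_top at_top"
  shows "\<exists>!x. 0 \<le> x \<and> H x = k"
proof -
  have "\<forall>\<^sub>F x in at_top. 0 \<le> x \<and> k \<le> H x"
    using lim eventually_ge_at_top[of 0] by (auto simp: filterlim_at_top intro: eventually_conj)
  then obtain N where "0 \<le> N" "k \<le> H N"
    using eventually_happens[of _ "at_top :: real filter"] by auto
  then obtain x where "0 \<le> x" "H x = k"
    using IVT'[of H 0 k N] H0 continuous_on_subset[OF cont] by auto
  moreover have "inj_on H {0..}" using mono by (rule strict_mono_on_imp_inj_on)
  ultimately show ?thesis by (auto dest: inj_onD)
qed

section \<open>The three cases of the regulator's weights\<close>

theorem mainTheorem1: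
  fixes a b wA wB :: real and H :: "real \<Rightarrow> real"
  assumes "a \<ge> b" and "b > 0"
    and "wA \<ge> 0" and "wB \<ge> 0" and "wA + wB = 1"
    and "\<forall>x\<ge>0. H x \<ge> 0"
    and "continuous_on {0..} H"
    and "strict_mono_on {0..} H"
    and "H 0 = 0"
    and "filterlim H at_top at_top"
  shows
    "(wA = wB \<longrightarrow>
       (\<forall>cs. NSE_intervention a b wA wB H UNIV cs \<longleftrightarrow> cs = 0)) \<and>
     (wA > wB \<longrightarrow>
       (\<exists>!c1. c1 \<ge> 0 \<and> H c1 = (wA - wB) * (b / (2 * a))) \<and>
       (\<forall>c1. c1 \<ge> 0 \<and> H c1 = (wA - wB) * (b / (2 * a)) \<longrightarrow>
         (\<forall>cs. NSE_intervention a b wA wB H UNIV cs \<longleftrightarrow>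
           is_arg_max (\<lambda>c. (wA - wB) * NE_payoff_A a b c - H (- c))
             (\<lambda>c. - c1 \<le> c \<and> c \<le> 0) cs))) \<and>
     (wA < wB \<longrightarrow>
       (\<exists>!c2. c2 \<ge> 0 \<and> H c2 = - (wA - wB) * (1 - b / (2 * a))) \<and>
       (\<forall>c2. c2 \<ge> 0 \<and> H c2 = - (wA - wB) * (1 - b / (2 * a)) \<longrightarrow>
         (\<forall>cs. NSE_intervention a b wA wB H UNIV cs \<longleftrightarrow>
           is_arg_max (\<lambda>c. (wA - wB) * NE_payoff_A a b c - H c)
             (\<lambda>c. 0 \<le> c \<and> c \<le> c2) cs)))"
proof (intro conjI impI allI)
  define J where "J = (\<lambda>c. (wA - wB) * NE_payoff_A a b c - H \<bar>c\<bar>)"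
  note ba = \<open>b > 0\<close> \<open>a \<ge> b\<close>
  have NSE: "NSE_intervention a b wA wB H UNIV cs \<longleftrightarrow> (\<forall>c. J c \<le> J cs)" for cs
    unfolding J_def by (rule NSE_intervention_iff[OF ba \<open>wA + wB = 1\<close>])
  note P0 = NE_payoff_A_0[OF ba] and P_le = NE_payoff_A_antimono[OF ba]
    and P_bounds = NE_payoff_A_bounds[OF ba]
  note H_less = strict_mono_onD[OF \<open>strict_mono_on {0..} H\<close>]
  note level = strict_mono_on_ex1_level
    [OF \<open>continuous_on {0..} H\<close> \<open>strict_mono_on {0..} H\<close> _ \<open>filterlim H at_top at_top\<close>]
  have H_pos: "0 < H \<bar>c\<bar>" if "c \<noteq> 0" for c using H_less[of 0 "\<bar>c\<bar>"] \<open>H 0 = 0\<close> that by simp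
  have J0: "J 0 = (wA - wB) * (1 - b / (2 * a))" using P0 \<open>H 0 = 0\<close> by (simp add: J_def)
  have ratio: "0 \<le> b / (2 * a)" "b / (2 * a) \<le> 1" using ba by (auto simp: field_simps)
  {
    fix cs assume "wA = wB"
    \<comment> \<open>With equal weights the followers' payoffs cancel and only the cost of
      intervening is left.\<close>
    then have J: "J c = - H \<bar>c\<bar>" for c by (simp add: J_def)
    show "NSE_intervention a b wA wB H UNIV cs \<longleftrightarrow> cs = 0"
    proof
      assume "NSE_intervention a b wA wB H UNIV cs"
      then have "J 0 \<le> J cs" unfolding NSE by blast
      then have "H \<bar>cs\<bar> \<le> 0" using \<open>H 0 = 0\<close> by (simp add: J)
      then show "cs = 0" using H_pos[of cs] by linarith
    next
      assume "cs = 0"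
      then show "NSE_intervention a b wA wB H UNIV cs"
        using \<open>\<forall>x\<ge>0. H x \<ge> 0\<close> \<open>H 0 = 0\<close> by (simp add: NSE J)
    qed
  next
    assume w: "wA > wB"
    show "\<exists>!c1. c1 \<ge> 0 \<and> H c1 = (wA - wB) * (b / (2 * a))"
      by (rule level) (use w ba \<open>H 0 = 0\<close> in auto)
    fix c1 cs assume c1: "c1 \<ge> 0 \<and> H c1 = (wA - wB) * (b / (2 * a))"
    have "J c < J 0" if c: "\<not> (- c1 \<le> c \<and> c \<le> 0)" for c
    proof (cases "0 < c")
      case True
      have "(wA - wB) * NE_payoff_A a b c \<le> (wA - wB) * NE_payoff_A a b 0"
        using P_le[of 0 c] True w by (intro mult_left_mono) auto
      then show ?thesis using H_pos[of c] True \<open>H 0 = 0\<close> by (simp add: J_def)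
    next
      case False
      \<comment> \<open>Here c < - c1. The cost H c1 equals (wA - wB) * (1 - P(0)), the most that
        can be gained over c = 0 when P \<le> 1, so a larger cost cannot be recovered.\<close>
      then have "H c1 < H \<bar>c\<bar>" using c c1 by (intro H_less) auto
      moreover have "(wA - wB) * NE_payoff_A a b c \<le> (wA - wB) * 1"
        using P_bounds(2)[of c] w by (intro mult_left_mono) auto
      ultimately show ?thesis unfolding J0 using c1 by (simp add: J_def right_diff_distrib)
    qed
    then show "NSE_intervention a b wA wB H UNIV cs \<longleftrightarrow>
        is_arg_max (\<lambda>c. (wA - wB) * NE_payoff_A a b c - H (- c)) (\<lambda>c. - c1 \<le> c \<and> c \<le> 0) cs"
      unfolding NSE using c1 by (intro global_max_iff_is_arg_max[where z = 0]) (auto simp: J_def)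
  next
    assume w: "wA < wB"
    have "(wA - wB) * (1 - b / (2 * a)) \<le> 0" using w ratio by (intro mult_nonpos_nonneg) auto
    then show "\<exists>!c2. c2 \<ge> 0 \<and> H c2 = - (wA - wB) * (1 - b / (2 * a))"
      by (intro level) (simp only: \<open>H 0 = 0\<close> mult_minus_left neg_0_le_iff_le)
    fix c2 cs assume c2: "c2 \<ge> 0 \<and> H c2 = - (wA - wB) * (1 - b / (2 * a))"
    \<comment> \<open>The level of c2 is the price of pushing P from P(0) down to 0. Beyond c2 the
      payoff term is at most 0, so J c \<le> - H \<bar>c\<bar> < - H c2 = J 0.\<close>
    then have J0': "J 0 = - H c2" unfolding J0 by (simp only: mult_minus_left minus_minus)
    have "J c < J 0" if c: "\<not> (0 \<le> c \<and> c \<le> c2)" for c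
    proof (cases "c < 0")
      case True
      have "(wA - wB) * NE_payoff_A a b c \<le> (wA - wB) * NE_payoff_A a b 0"
        using P_le[of c 0] True w by (intro mult_left_mono_neg) auto
      then show ?thesis using H_pos[of c] True \<open>H 0 = 0\<close> by (simp add: J_def)
    next
      case False
      then have "H c2 < H \<bar>c\<bar>" using c c2 by (intro H_less) auto
      moreover have "(wA - wB) * NE_payoff_A a b c \<le> 0"
        using P_bounds(1)[of c] w by (intro mult_nonpos_nonneg) auto
      ultimately show ?thesis unfolding J0' by (simp add: J_def)
    qed
    then show "NSE_intervention a b wA wB H UNIV cs \<longleftrightarrow>
        is_arg_max (\<lambda>c. (wA - wB) * NE_payoff_A a b c - H c) (\<lambda>c. 0 \<le> c \<and> c \<le> c2) cs"
      unfolding NSE using c2 by (intro global_max_iff_is_arg_max[where z = 0]) (auto simp: J_def)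
  }
qed

end
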